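(* Let $Y$, $Z$ and $B$ be $k$-spaces, let $(Z,z_{o})$ be a homotopy Abelian $H$-group with multiplication $m$ and identity $z_o$, let $(B,b_{o})$ be a based weak Hausdorff space, and let $q:Y\to B$ be a continuous map. Then (a) the set $[Y,Y|b_{o};Z,z_{o}]$ carries an Abelian group structure, defined by pointwise addition of homotopy classes (using $m$); and (b) the bijection $\lambda:[Y,Y|b_{o};Z,z_{o}]\to\Pi_{o}(Sec^{o}(q!Z))$, $\lambda[\ell]=[\ell^{\bullet}]$, where $\ell^{\bullet}(b)=\ell|(Y|b):Y|b\to Z$ for $b\in B$, is an isomorphism of groups.
   Context: For a topological space $X$, $kX$ is the set $X$ with the final topology relative to all continuous maps $C\to X$ from compact Hausdorff spaces $C$; $X$ is a $k$-space if $kX=X$. All spaces are $k$-spaces and all constructions are $k$-ified: $X\times Y$ means $k$ of the usual product, pullbacks $X\sqcap Y$ have the $k$-ification of the subspace topology, and $M(Y,Z)$ is the set of continuous maps $Y\to Z$ with the $k$-ification of the compact-open topology. $B$ is weak Hausdorff if its diagonal is closed in the ($k$-ified) product $B\times B$ (this implies $B$ is $T_1$). Free range mapping space: for a map $q:Y\to B$, with $B$ a $T_1$ space, and $Y|b=q^{-1}(b)$, the set $Y!Z$ is $\bigcup_{b\in B}M(Y|b,Z)$ (disjoint union), and $q!Z:Y!Z\to B$ sends every map $Y|b\to Z$ to $b$. Let $Z^{\sim}=Z\cup\{\omega\}$, $\omega\notin Z$, with closed sets $Z^{\sim}$ and the closed sets of $Z$. For $f:Y|b\to Z$ let $i(f):Y\to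 Z^{\sim}$ equal $f$ on $Y|b$ and $\omega$ elsewhere. $Y!Z$ carries the $k$-ification of the initial topology relative to $i:Y!Z\to M(Y,Z^{\sim})$ and $q!Z$. The basepoint of $Y!Z$ is the constant map $Y|b_{o}\to Z$ with value $z_{o}$. $[Y,Y|b_{o};Z,z_{o}]$ is the set of homotopy classes of maps of pairs $(Y,Y|b_{o})\to(Z,z_{o})$, under homotopies of pairs. $Sec^{o}(q!Z)$ is the space of basepoint-preserving sections to $q!Z$, and $\Pi_{o}(Sec^{o}(q!Z))$ the set of classes of such sections under based vertical homotopy (homotopy through based sections). Pointwise addition: $[\ell_1]+[\ell_2]=[y\mapsto m(\ell_1(y),\ell_2(y))]$. The group structure on $\Pi_{o}(Sec^{o}(q!Z))$ is $[t_1]+[t_2]=[n\circ\langle t_1,t_2\rangle]$, where $n(f,g)=m\circ(f\times g)\circ\triangle_b$ for $f,g\in M(Y|b,Z)$, $\triangle_b$ being the diagonal of $Y|b$. *)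

theory Defs
  imports "HOL-Analysis.Analysis" "HOL-Algebra.Group"
begin

no_notation eq_closure_of ("closure'_of\<index>")

text \<open>
  The k-ification of \<open>X\<close> is the final topology for all continuous maps into \<open>X\<close> from compact
  Hausdorff spaces. A definition in HOL can only quantify over the compact Hausdorff spaces on one
  fixed type; the type chosen here is large enough that nothing is lost, see
  \<open>continuous_map_into_kify\<close> and \<open>openin_kify_test\<close>, where the domain has an arbitrary type. Note
  that the library's \<open>k_space\<close> is a different notion (it tests on compact subspaces, Hausdorff or
  not).
\<close>

definition kify :: "'a topology \<Rightarrow> 'a topology" where
  "kify X = topology (\<lambda>U. U \<subseteq> topspace X \<and>
     (\<forall>(C :: 'a set list set set topology) f.
        compact_space C \<and> Hausdorff_space C \<and> continuous_map C X f
          \<longrightarrow> openin C {c \<in> topspace C. f c \<in> U}))"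

definition is_k_space :: "'a topology \<Rightarrow> bool" where
  "is_k_space X \<longleftrightarrow> kify X = X"

lemma openin_kify:
  fixes X :: "'a topology"
  shows "openin (kify X) U \<longleftrightarrow> U \<subseteq> topspace X \<and>
     (\<forall>(C :: 'a set list set set topology) f.
        compact_space C \<and> Hausdorff_space C \<and> continuous_map C X f
          \<longrightarrow> openin C {c \<in> topspace C. f c \<in> U})"
proof -
  define P where "P = (\<lambda>U. U \<subseteq> topspace X \<and>
     (\<forall>(C :: 'a set list set set topology) f.
        compact_space C \<and> Hausdorff_space C \<and> continuous_map C X f
          \<longrightarrow> openin C {c \<in> topspace C. f c \<in> U}))"
  have "istopology P"
    unfolding istopology_def
  proof (intro conjI allI impI)
    fix S T assume S: "P S" and T: "P T"
    show "P (S \<inter> T)"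
      unfolding P_def
    proof (intro conjI allI impI)
      show "S \<inter> T \<subseteq> topspace X" using S by (auto simp: P_def)
      fix C :: "'a set list set set topology" and f
      assume *: "compact_space C \<and> Hausdorff_space C \<and> continuous_map C X f"
      have eq: "{c \<in> topspace C. f c \<in> S \<inter> T} = {c \<in> topspace C. f c \<in> S} \<inter> {c \<in> topspace C. f c \<in> T}"
        by auto
      have "openin C {c \<in> topspace C. f c \<in> S}" "openin C {c \<in> topspace C. f c \<in> T}"
        using S T * unfolding P_def by blast+
      then show "openin C {c \<in> topspace C. f c \<in> S \<inter> T}"
        unfolding eq by (rule openin_Int)
    qed
  next
    fix K assume K: "\<forall>S\<in>K. P S"
    show "P (\<Union>K)"
      unfolding P_def
    proof (intro conjI allI impI)
      show "\<Union>K \<subseteq> topspace X" using K by (auto simp: P_def)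
      fix C :: "'a set list set set topology" and f
      assume *: "compact_space C \<and> Hausdorff_space C \<and> continuous_map C X f"
      have eq: "{c \<in> topspace C. f c \<in> \<Union>K} = (\<Union>S\<in>K. {c \<in> topspace C. f c \<in> S})"
        by auto
      have "openin C {c \<in> topspace C. f c \<in> S}" if "S \<in> K" for S
        using K that * unfolding P_def by blast
      then show "openin C {c \<in> topspace C. f c \<in> \<Union>K}"
        unfolding eq by (intro openin_Union) auto
    qed
  qed
  then have "openin (kify X) U \<longleftrightarrow> P U"
    unfolding kify_def P_def[symmetric] by (simp only: topology_inverse')
  then show ?thesis
    unfolding P_def .
qed

lemma openin_imp_openin_kify: "openin X U \<Longrightarrow> openin (kify X) U"
  unfolding openin_kify by (blast dest: openin_subset openin_continuous_map_preimage)

lemma topspace_kify [simp]: "topspace (kify X) = topspace X"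
proof
  show "topspace (kify X) \<subseteq> topspace X"
    by (meson openin_kify openin_topspace)
  show "topspace X \<subseteq> topspace (kify X)"
    by (simp add: openin_imp_openin_kify openin_subset)
qed

lemma homeomorphic_copy:
  assumes "inj_on e (topspace C)"
  obtains C' where "homeomorphic_maps C C' e (inv_into (topspace C) e)"
proof
  let ?g = "inv_into (topspace C) e"
  let ?C' = "pullback_topology (e ` topspace C) ?g C"
  have t: "topspace ?C' = e ` topspace C"
    using assms by (auto simp: topspace_pullback_topology)
  have "continuous_map ?C' C ?g"
    by (metis continuous_map_id continuous_map_pullback id_comp)
  moreover have "continuous_map C ?C' e"
  proof (rule continuous_map_pullback')
    show "continuous_map C C (?g \<circ> e)"
      by (rule continuous_map_eq [OF continuous_map_id]) (use assms in auto)
  qed auto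
  ultimately show "homeomorphic_maps C ?C' e ?g"
    using assms by (auto simp: homeomorphic_maps_def t)
qed

text \<open>Every compact Hausdorff space whose points inject into the test type is a test space.\<close>

lemma openin_kify_inj:
  fixes X :: "'a topology" and C :: "'c topology" and e :: "'c \<Rightarrow> 'a set list set set"
  assumes "compact_space C" "Hausdorff_space C" "continuous_map C X f" "openin (kify X) U"
    and "inj_on e (topspace C)"
  shows "openin C {c \<in> topspace C. f c \<in> U}"
proof -
  let ?g = "inv_into (topspace C) e"
  obtain C' where h: "homeomorphic_maps C C' e ?g"
    using homeomorphic_copy assms(5) by blast
  then have hs: "C homeomorphic_space C'"
    by (auto simp: homeomorphic_space_def)
  have "compact_space C'" "Hausdorff_space C'"
    using hs assms(1,2) homeomorphic_compact_space homeomorphic_Hausdorff_space by metis+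
  moreover have "continuous_map C' X (f \<circ> ?g)"
    using h assms(3) by (intro continuous_map_compose) (auto simp: homeomorphic_maps_def)
  ultimately have "openin C' {c \<in> topspace C'. (f \<circ> ?g) c \<in> U}"
    using assms(4) unfolding openin_kify by blast
  then have "openin C {c \<in> topspace C. e c \<in> {c \<in> topspace C'. (f \<circ> ?g) c \<in> U}}"
    using h by (intro openin_continuous_map_preimage) (auto simp: homeomorphic_maps_def)
  moreover have "{c \<in> topspace C. e c \<in> {c \<in> topspace C'. (f \<circ> ?g) c \<in> U}} = {c \<in> topspace C. f c \<in> U}"
    using h assms(5) by (auto simp: homeomorphic_maps_def continuous_map_def)
  ultimately show ?thesis by simp
qed

lemma openin_kify_specialization:
  fixes X :: "'a topology"
  assumes U: "openin (kify X) U" "x \<in> U" and y: "y \<in> topspace X"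
    and le: "\<And>V. openin X V \<Longrightarrow> x \<in> V \<Longrightarrow> y \<in> V"
  shows "y \<in> U"
proof (rule ccontr)
  assume nU: "y \<notin> U"
  define K where "K = insert 0 (range (\<lambda>n. inverse (real (Suc n))))"
  define f where "f = (\<lambda>t::real. if t = 0 then x else y)"
  have lim: "(\<lambda>n. inverse (real (Suc n))) \<longlonglongrightarrow> 0"
    by (rule LIMSEQ_inverse_real_of_nat)
  have K: "compact K"
    unfolding K_def using compact_sequence_with_limit[OF lim] by simp
  have "countable K" by (auto simp: K_def)
  then obtain g :: "real \<Rightarrow> nat" where g: "inj_on g K"
    using countableE by blast
  define e :: "real \<Rightarrow> 'a set list set set" where "e = (\<lambda>t. {{replicate (g t) undefined}})"
  have e: "inj_on e K"
    using g by (auto simp: inj_on_def e_def)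
  have x: "x \<in> topspace X"
    using U by (meson openin_kify subsetD)
  have f: "continuous_map (top_of_set K) X f"
    unfolding continuous_map_def
  proof (intro conjI allI impI)
    show "f \<in> topspace (top_of_set K) \<rightarrow> topspace X"
      using x y by (auto simp: f_def)
    fix V assume V: "openin X V"
    show "openin (top_of_set K) {t \<in> topspace (top_of_set K). f t \<in> V}"
    proof (cases "x \<in> V")
      case True
      then have "{t \<in> topspace (top_of_set K). f t \<in> V} = topspace (top_of_set K)"
        using le[OF V] by (auto simp: f_def)
      then show ?thesis by simp
    next
      case False
      then have "{t \<in> topspace (top_of_set K). f t \<in> V} = (if y \<in> V then K \<inter> (- {0}) else {})"
        by (auto simp: f_def)
      then show ?thesis by (auto intro!: openin_open_Int)
    qed
  qed
  have "openin (top_of_set K) {t \<in> topspace (top_of_set K). f t \<in> U}"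
    by (rule openin_kify_inj[OF _ _ f U(1), of e])
      (use K e in \<open>auto simp: compact_space_subtopology Hausdorff_space_subtopology\<close>)
  moreover have "{t \<in> topspace (top_of_set K). f t \<in> U} = {0}"
    using U nU by (auto simp: f_def K_def)
  ultimately obtain T where T: "open T" "K \<inter> T = {0}"
    by (metis openin_open)
  then have "0 \<in> T" by blast
  then obtain n where "inverse (real (Suc n)) \<in> T"
    using topological_tendstoD[OF lim T(1)] unfolding eventually_sequentially by blast
  moreover have "inverse (real (Suc n)) \<in> K" by (auto simp: K_def)
  ultimately have "inverse (real (Suc n)) = 0" using T(2) by blast
  then show False by simp
qed

theorem openin_kify_test:
  fixes X :: "'a topology" and C :: "'c topology"
  assumes C: "compact_space C" "Hausdorff_space C" and f: "continuous_map C X f"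
    and U: "openin (kify X) U"
  shows "openin C {c \<in> topspace C. f c \<in> U}"
proof (rule ccontr)
  assume "\<not> ?thesis"
  then obtain c where c: "c \<in> topspace C" "f c \<in> U"
    and nc: "\<And>T. openin C T \<Longrightarrow> c \<in> T \<Longrightarrow> \<not> T \<subseteq> {c \<in> topspace C. f c \<in> U}"
    by (subst (asm) openin_subopen) blast
  define \<V> where "\<V> = {V. openin X V \<and> f c \<in> V}"
  have "\<exists>W. openin C W \<and> c \<in> W \<and> C closure_of W \<subseteq> {d \<in> topspace C. f d \<in> V}" if "V \<in> \<V>" for V
  proof -
    let ?D = "topspace C - {d \<in> topspace C. f d \<in> V}"
    have "closedin C ?D"
      using that f by (auto simp: \<V>_def intro: openin_continuous_map_preimage)
    moreover have "c \<in> topspace C - ?D" using that c by (auto simp: \<V>_def)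
    ultimately obtain W where "openin C W" "c \<in> W" "disjnt ?D (C closure_of W)"
      using compact_Hausdorff_imp_regular_space[OF C] unfolding regular_space by blast
    then show ?thesis
      using closure_of_subset_topspace[of C W] by (auto simp: disjnt_iff subset_iff)
  qed
  then obtain W where W: "\<And>V. V \<in> \<V> \<Longrightarrow> openin C (W V) \<and> c \<in> W V \<and>
      C closure_of (W V) \<subseteq> {d \<in> topspace C. f d \<in> V}"
    by metis
  have "\<exists>d. d \<in> topspace C \<and> f d \<notin> U \<and> (\<forall>V\<in>set L. d \<in> W V)" if "L \<in> lists \<V>" for L
  proof -
    let ?T = "topspace C \<inter> \<Inter>(W ` set L)"
    have "openin C ?T"
      using that W by (intro openin_Int_Inter) auto
    moreover have "c \<in> ?T" using that W c by auto
    ultimately show ?thesis using nc[of ?T] by blast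
  qed
  then obtain p where p: "\<And>L. L \<in> lists \<V> \<Longrightarrow> p L \<in> topspace C \<and> f (p L) \<notin> U \<and> (\<forall>V\<in>set L. p L \<in> W V)"
    by metis
  define D where "D = C closure_of (p ` lists \<V>)"
  have Dsub: "D \<subseteq> topspace C" by (simp add: D_def closure_of_subset_topspace)
  define e where "e = (\<lambda>d. {A. A \<subseteq> lists \<V> \<and> d \<in> C closure_of (p ` A)})"
  have inj: "inj_on e D"
  proof (rule inj_onI, rule ccontr)
    fix d d' assume dd: "d \<in> D" "d' \<in> D" "e d = e d'" "d \<noteq> d'"
    then obtain S T where ST: "openin C S" "openin C T" "d \<in> S" "d' \<in> T" "disjnt S T"
      using C(2) Dsub unfolding Hausdorff_space_def by (meson subsetD)
    let ?A = "{L \<in> lists \<V>. p L \<in> S}"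
    have "d \<in> C closure_of (p ` ?A)"
      unfolding in_closure_of
    proof (intro conjI allI impI)
      show "d \<in> topspace C" using dd Dsub by blast
      fix T' assume T': "d \<in> T' \<and> openin C T'"
      then have "openin C (T' \<inter> S)" "d \<in> T' \<inter> S" using ST by auto
      then obtain y where "y \<in> p ` lists \<V>" "y \<in> T' \<inter> S"
        using dd(1) unfolding D_def in_closure_of by blast
      then show "\<exists>y. y \<in> p ` ?A \<and> y \<in> T'" by auto
    qed
    then have "?A \<in> e d" by (auto simp: e_def)
    then have "d' \<in> C closure_of (p ` ?A)" unfolding dd(3) by (simp add: e_def)
    then obtain y where "y \<in> p ` ?A" "y \<in> T"
      using ST unfolding in_closure_of by blast
    then show False using ST(5) by (auto simp: disjnt_iff)
  qed
  let ?Q = "\<lambda>V. C closure_of (p ` {L \<in> lists \<V>. V \<in> set L})"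
  have top: "topspace X \<in> \<V>"
    using c f by (auto simp: \<V>_def continuous_map_def)
  have "\<Inter>(?Q ` \<V>) \<noteq> {}"
  proof -
    have fip: "\<Inter>\<F> \<noteq> {}" if F: "finite \<F>" "\<F> \<subseteq> ?Q ` \<V>" for \<F>
    proof -
      obtain \<G> where G: "finite \<G>" "\<G> \<subseteq> \<V>" "\<F> = ?Q ` \<G>"
        using finite_subset_image[OF F] by blast
      obtain L where L: "set L = \<G>" using G(1) finite_list by blast
      then have Lin: "L \<in> lists \<V>" using G(2) by auto
      have "p L \<in> ?Q V" if "V \<in> \<G>" for V
        by (rule subsetD[OF closure_of_subset]) (use p Lin L that in auto)
      then have "p L \<in> \<Inter>\<F>" using G(3) by blast
      then show ?thesis by blast
    qed
    show ?thesis
    proof (rule C(1)[unfolded compact_space_fip, rule_format])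
      show "(\<forall>S\<in>?Q ` \<V>. closedin C S) \<and> (\<forall>\<F>. finite \<F> \<and> \<F> \<subseteq> ?Q ` \<V> \<longrightarrow> \<Inter>\<F> \<noteq> {})"
        using fip by simp
    qed
  qed
  then obtain c' where c': "\<And>V. V \<in> \<V> \<Longrightarrow> c' \<in> ?Q V" by blast
  have c'D: "c' \<in> D"
    using c'[OF top] unfolding D_def by (rule subsetD[OF closure_of_mono, rotated]) auto
  have le: "f c' \<in> V" if "openin X V" "f c \<in> V" for V
  proof -
    have V: "V \<in> \<V>" using that by (simp add: \<V>_def)
    have "?Q V \<subseteq> C closure_of (W V)"
      by (rule closure_of_mono) (use p in auto)
    then show ?thesis using c'[OF V] W[OF V] by blast
  qed
  have "f c' \<in> topspace X"
    using f c'D Dsub by (auto simp: continuous_map_def)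
  then have c'U: "f c' \<in> U"
    by (rule openin_kify_specialization[OF U c(2) _ le])
  let ?C = "subtopology C D"
  have tC: "topspace ?C = D" using Dsub by auto
  have "closedin C D" by (simp add: D_def)
  then have "compact_space ?C"
    using C(1) closedin_compact_space compact_space_subtopology by blast
  moreover have "Hausdorff_space ?C" using C(2) by (rule Hausdorff_space_subtopology)
  moreover have "continuous_map ?C X f" using f by (rule continuous_map_from_subtopology)
  ultimately have "openin ?C {d \<in> topspace ?C. f d \<in> U}"
    by (rule openin_kify_inj[OF _ _ _ U, of _ _ e]) (use inj tC in auto)
  then obtain T where T: "openin C T" "{d \<in> D. f d \<in> U} = T \<inter> D"
    unfolding tC openin_subtopology by blast
  then have "c' \<in> T" using c'U c'D by blast
  then obtain y where y: "y \<in> p ` lists \<V>" "y \<in> T"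
    using c'D T(1) unfolding D_def in_closure_of by blast
  then have "y \<in> D"
    unfolding D_def by (intro subsetD[OF closure_of_subset]) (use p in auto)
  then have "f y \<in> U" using y T(2) by blast
  then show False using y p by blast
qed

corollary continuous_map_into_kify:
  fixes X :: "'a topology" and C :: "'c topology"
  assumes "compact_space C" "Hausdorff_space C"
  shows "continuous_map C (kify X) f \<longleftrightarrow> continuous_map C X f"
proof
  assume f: "continuous_map C X f"
  show "continuous_map C (kify X) f"
    unfolding continuous_map_def
  proof (intro conjI allI impI)
    show "f \<in> topspace C \<rightarrow> topspace (kify X)"
      using f by (simp add: continuous_map_def)
  qed (rule openin_kify_test[OF assms f])
next
  assume "continuous_map C (kify X) f"
  then show "continuous_map C X f"
    by (auto simp: continuous_map_def openin_imp_openin_kify)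
qed

definition kprod :: "'a topology \<Rightarrow> 'b topology \<Rightarrow> ('a \<times> 'b) topology" where
  "kprod X Y = kify (prod_topology X Y)"

definition weak_Hausdorff :: "'a topology \<Rightarrow> bool" where
  "weak_Hausdorff B \<longleftrightarrow> closedin (kprod B B) ((\<lambda>b. (b, b)) ` topspace B)"

text \<open>
  Maps are represented by functions that are \<open>undefined\<close> outside the domain, so that equality of
  maps is equality of HOL functions.
\<close>

definition maps :: "'a topology \<Rightarrow> 'b topology \<Rightarrow> ('a \<Rightarrow> 'b) set" where
  "maps X Z = {f \<in> extensional (topspace X). continuous_map X Z f}"

definition compact_open :: "'a topology \<Rightarrow> 'b topology \<Rightarrow> ('a \<Rightarrow> 'b) topology" where
  "compact_open X Z = topology_generated_by
     {{f \<in> maps X Z. f ` K \<subseteq> U} | K U. compactin X K \<and> openin Z U}"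

definition mapping_space :: "'a topology \<Rightarrow> 'b topology \<Rightarrow> ('a \<Rightarrow> 'b) topology" where
  "mapping_space X Z = kify (compact_open X Z)"

text \<open>
  As \<open>homotopic_with\<close>, but with the k-ified product with the unit interval, and with no condition
  on values outside the domain.
\<close>

definition khomotopic_with ::
    "(('a \<Rightarrow> 'b) \<Rightarrow> bool) \<Rightarrow> 'a topology \<Rightarrow> 'b topology \<Rightarrow> ('a \<Rightarrow> 'b) \<Rightarrow> ('a \<Rightarrow> 'b) \<Rightarrow> bool" where
  "khomotopic_with P X Z f g \<longleftrightarrow>
     (\<exists>h. continuous_map (kprod X (top_of_set {0..1::real})) Z h \<and>
          (\<forall>x\<in>topspace X. h (x, 0) = f x) \<and>
          (\<forall>x\<in>topspace X. h (x, 1) = g x) \<and>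
          (\<forall>t\<in>{0..1}. P (\<lambda>x. h (x, t))))"

definition pair_homotopic ::
    "'a topology \<Rightarrow> 'a set \<Rightarrow> 'b topology \<Rightarrow> 'b set \<Rightarrow> ('a \<Rightarrow> 'b) \<Rightarrow> ('a \<Rightarrow> 'b) \<Rightarrow> bool" where
  "pair_homotopic X A Z D = khomotopic_with (\<lambda>f. f ` A \<subseteq> D) X Z"

abbreviation based_homotopic ::
    "'a topology \<Rightarrow> 'a \<Rightarrow> 'b topology \<Rightarrow> 'b \<Rightarrow> ('a \<Rightarrow> 'b) \<Rightarrow> ('a \<Rightarrow> 'b) \<Rightarrow> bool" where
  "based_homotopic X x Z z \<equiv> pair_homotopic X {x} Z {z}"

text \<open>H-groups in the category of based spaces: all maps and homotopies preserve basepoints.\<close>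

definition H_group :: "'z topology \<Rightarrow> 'z \<Rightarrow> ('z \<times> 'z \<Rightarrow> 'z) \<Rightarrow> bool" where
  "H_group Z z0 m \<longleftrightarrow>
     z0 \<in> topspace Z \<and> continuous_map (kprod Z Z) Z m \<and> m (z0, z0) = z0 \<and>
     based_homotopic Z z0 Z z0 (\<lambda>z. m (z0, z)) (\<lambda>z. z) \<and>
     based_homotopic Z z0 Z z0 (\<lambda>z. m (z, z0)) (\<lambda>z. z) \<and>
     based_homotopic (kprod (kprod Z Z) Z) ((z0, z0), z0) Z z0
       (\<lambda>((x, y), z). m (m (x, y), z)) (\<lambda>((x, y), z). m (x, m (y, z))) \<and>
     (\<exists>j. continuous_map Z Z j \<and> j z0 = z0 \<and>
        based_homotopic Z z0 Z z0 (\<lambda>z. m (z, j z)) (\<lambda>_. z0) \<and>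
        based_homotopic Z z0 Z z0 (\<lambda>z. m (j z, z)) (\<lambda>_. z0))"

definition homotopy_abelian_H_group :: "'z topology \<Rightarrow> 'z \<Rightarrow> ('z \<times> 'z \<Rightarrow> 'z) \<Rightarrow> bool" where
  "homotopy_abelian_H_group Z z0 m \<longleftrightarrow> H_group Z z0 m \<and>
     based_homotopic (kprod Z Z) (z0, z0) Z z0 (\<lambda>(x, y). m (y, x)) m"

definition pair_maps :: "'a topology \<Rightarrow> 'a set \<Rightarrow> 'b topology \<Rightarrow> 'b set \<Rightarrow> ('a \<Rightarrow> 'b) set" where
  "pair_maps X A Z D = {f \<in> maps X Z. f ` A \<subseteq> D}"

definition pair_rel ::
    "'a topology \<Rightarrow> 'a set \<Rightarrow> 'b topology \<Rightarrow> 'b set \<Rightarrow> (('a \<Rightarrow> 'b) \<times> ('a \<Rightarrow> 'b)) set" where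
  "pair_rel X A Z D = {(f, g). f \<in> pair_maps X A Z D \<and> g \<in> pair_maps X A Z D \<and>
     pair_homotopic X A Z D f g}"

definition pair_class ::
    "'a topology \<Rightarrow> 'a set \<Rightarrow> 'b topology \<Rightarrow> 'b set \<Rightarrow> ('a \<Rightarrow> 'b) \<Rightarrow> ('a \<Rightarrow> 'b) set" where
  "pair_class X A Z D f = pair_rel X A Z D `` {f}"

definition pointwise_add ::
    "'a topology \<Rightarrow> ('z \<times> 'z \<Rightarrow> 'z) \<Rightarrow> ('a \<Rightarrow> 'z) \<Rightarrow> ('a \<Rightarrow> 'z) \<Rightarrow> 'a \<Rightarrow> 'z" where
  "pointwise_add X m f g = (\<lambda>x\<in>topspace X. m (f x, g x))"

definition pair_class_group ::
    "'a topology \<Rightarrow> 'a set \<Rightarrow> 'z topology \<Rightarrow> 'z \<Rightarrow> ('z \<times> 'z \<Rightarrow> 'z) \<Rightarrow> ('a \<Rightarrow> 'z) set monoid" where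
  "pair_class_group X A Z z0 m =
     \<lparr>carrier = pair_maps X A Z {z0} // pair_rel X A Z {z0},
      mult = (\<lambda>c d. \<Union>f\<in>c. \<Union>g\<in>d. pair_class X A Z {z0} (pointwise_add X m f g)),
      one = pair_class X A Z {z0} (\<lambda>x\<in>topspace X. z0)\<rparr>"

definition fibre :: "'y topology \<Rightarrow> ('y \<Rightarrow> 'b) \<Rightarrow> 'b \<Rightarrow> 'y set" where
  "fibre Y q b = {y \<in> topspace Y. q y = b}"

definition fibre_space :: "'y topology \<Rightarrow> ('y \<Rightarrow> 'b) \<Rightarrow> 'b \<Rightarrow> 'y topology" where
  "fibre_space Y q b = kify (subtopology Y (fibre Y q b))"

text \<open>The space \<open>Z\<^sup>\<sim>\<close>, with \<open>None\<close> in the role of \<open>\<omega>\<close>.\<close>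

definition tilde :: "'z topology \<Rightarrow> 'z option topology" where
  "tilde Z = topology (\<lambda>U. U = {} \<or> (\<exists>V. openin Z V \<and> U = insert None (Some ` V)))"

lemma openin_tilde:
  "openin (tilde Z) U \<longleftrightarrow> U = {} \<or> (\<exists>V. openin Z V \<and> U = insert None (Some ` V))"
proof -
  have "istopology (\<lambda>U. U = {} \<or> (\<exists>V. openin Z V \<and> U = insert None (Some ` V)))"
    (is "istopology ?P")
    unfolding istopology_def
  proof (intro conjI allI impI)
    fix S T assume ST: "?P S" "?P T"
    show "?P (S \<inter> T)"
    proof (cases "S = {} \<or> T = {}")
      case False
      then obtain V W where VW: "openin Z V" "S = insert None (Some ` V)"
          "openin Z W" "T = insert None (Some ` W)"
        using ST by blast
      then have "openin Z (V \<inter> W)" "S \<inter> T = insert None (Some ` (V \<inter> W))"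
        by auto
      then show ?thesis by metis
    qed auto
  next
    fix K assume K: "\<forall>S\<in>K. ?P S"
    show "?P (\<Union>K)"
    proof (cases "\<Union>K = {}")
      case False
      let ?V = "\<Union>{V. openin Z V \<and> insert None (Some ` V) \<in> K}"
      have "openin Z ?V" by (rule openin_Union) simp
      moreover have "\<Union>K = insert None (Some ` ?V)"
      proof
        show "\<Union>K \<subseteq> insert None (Some ` ?V)"
        proof
          fix u assume "u \<in> \<Union>K"
          then obtain V where "openin Z V" "insert None (Some ` V) \<in> K" "u \<in> insert None (Some ` V)"
            using K by (metis UnionE empty_iff)
          then show "u \<in> insert None (Some ` ?V)" by auto
        qed
        obtain S where "S \<in> K" "S \<noteq> {}" using False by auto
        then have "None \<in> \<Union>K" using K by (metis UnionI insertI1)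
        then show "insert None (Some ` ?V) \<subseteq> \<Union>K" by auto
      qed
      ultimately show ?thesis by metis
    qed auto
  qed
  then show ?thesis by (simp add: tilde_def topology_inverse')
qed

lemma topspace_tilde: "topspace (tilde Z) = insert None (Some ` topspace Z)"
proof
  show "topspace (tilde Z) \<subseteq> insert None (Some ` topspace Z)"
    using openin_topspace[of "tilde Z"] openin_subset[of Z] unfolding openin_tilde by blast
  show "insert None (Some ` topspace Z) \<subseteq> topspace (tilde Z)"
    by (rule openin_subset) (use openin_tilde openin_topspace in blast)
qed

lemma closedin_tilde:
  "closedin (tilde Z) F \<longleftrightarrow> F = topspace (tilde Z) \<or> (\<exists>S. closedin Z S \<and> F = Some ` S)"
proof
  assume F: "closedin (tilde Z) F"
  then have sub: "F \<subseteq> topspace (tilde Z)" by (rule closedin_subset)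
  from F consider "topspace (tilde Z) - F = {}"
    | V where "openin Z V" "topspace (tilde Z) - F = insert None (Some ` V)"
    by (auto simp: closedin_def openin_tilde)
  then show "F = topspace (tilde Z) \<or> (\<exists>S. closedin Z S \<and> F = Some ` S)"
  proof cases
    case 1 then show ?thesis using sub by blast
  next
    case (2 V)
    have "F = topspace (tilde Z) - insert None (Some ` V)" using 2(2) sub by blast
    also have "\<dots> = Some ` (topspace Z - V)" by (auto simp: topspace_tilde)
    finally show ?thesis using 2(1) by blast
  qed
next
  assume "F = topspace (tilde Z) \<or> (\<exists>S. closedin Z S \<and> F = Some ` S)"
  then show "closedin (tilde Z) F"
  proof
    assume "\<exists>S. closedin Z S \<and> F = Some ` S"
    then obtain S where S: "closedin Z S" "F = Some ` S" by blast
    have "topspace (tilde Z) - F = insert None (Some ` (topspace Z - S))"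
      using S by (auto simp: topspace_tilde)
    moreover have "F \<subseteq> topspace (tilde Z)"
      using S closedin_subset by (auto simp: topspace_tilde)
    ultimately show ?thesis using S(1) by (auto simp: closedin_def openin_tilde)
  qed auto
qed

text \<open>
  The points over \<open>b\<close> are pairs \<open>(b, f)\<close>: the union defining \<open>Y!Z\<close> is disjoint, also when
  several fibres are empty.
\<close>

definition free_range_maps ::
    "'y topology \<Rightarrow> 'b topology \<Rightarrow> ('y \<Rightarrow> 'b) \<Rightarrow> 'z topology \<Rightarrow> ('b \<times> ('y \<Rightarrow> 'z)) set" where
  "free_range_maps Y B q Z = (SIGMA b:topspace B. maps (fibre_space Y q b) Z)"

definition free_range_proj :: "'b \<times> ('y \<Rightarrow> 'z) \<Rightarrow> 'b" where
  "free_range_proj = fst"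

definition free_range_incl ::
    "'y topology \<Rightarrow> ('y \<Rightarrow> 'b) \<Rightarrow> 'b \<times> ('y \<Rightarrow> 'z) \<Rightarrow> 'y \<Rightarrow> 'z option" where
  "free_range_incl Y q = (\<lambda>(b, f). \<lambda>y\<in>topspace Y. if y \<in> fibre Y q b then Some (f y) else None)"

definition free_range_space ::
    "'y topology \<Rightarrow> 'b topology \<Rightarrow> ('y \<Rightarrow> 'b) \<Rightarrow> 'z topology \<Rightarrow> ('b \<times> ('y \<Rightarrow> 'z)) topology" where
  "free_range_space Y B q Z = kify (topology_generated_by
     ({{u \<in> free_range_maps Y B q Z. free_range_incl Y q u \<in> U} | U.
          openin (mapping_space Y (tilde Z)) U} \<union>
      {{u \<in> free_range_maps Y B q Z. free_range_proj u \<in> V} | V. openin B V}))"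

definition free_range_base ::
    "'y topology \<Rightarrow> ('y \<Rightarrow> 'b) \<Rightarrow> 'b \<Rightarrow> 'z \<Rightarrow> 'b \<times> ('y \<Rightarrow> 'z)" where
  "free_range_base Y q b0 z0 = (b0, \<lambda>y\<in>fibre Y q b0. z0)"

definition is_based_section ::
    "'y topology \<Rightarrow> 'b topology \<Rightarrow> ('y \<Rightarrow> 'b) \<Rightarrow> 'z topology \<Rightarrow> 'b \<Rightarrow> 'z \<Rightarrow>
     ('b \<Rightarrow> 'b \<times> ('y \<Rightarrow> 'z)) \<Rightarrow> bool" where
  "is_based_section Y B q Z b0 z0 s \<longleftrightarrow>
     continuous_map B (free_range_space Y B q Z) s \<and>
     (\<forall>b\<in>topspace B. free_range_proj (s b) = b) \<and> s b0 = free_range_base Y q b0 z0"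

definition based_sections ::
    "'y topology \<Rightarrow> 'b topology \<Rightarrow> ('y \<Rightarrow> 'b) \<Rightarrow> 'z topology \<Rightarrow> 'b \<Rightarrow> 'z \<Rightarrow>
     ('b \<Rightarrow> 'b \<times> ('y \<Rightarrow> 'z)) set" where
  "based_sections Y B q Z b0 z0 =
     {s \<in> extensional (topspace B). is_based_section Y B q Z b0 z0 s}"

definition section_rel ::
    "'y topology \<Rightarrow> 'b topology \<Rightarrow> ('y \<Rightarrow> 'b) \<Rightarrow> 'z topology \<Rightarrow> 'b \<Rightarrow> 'z \<Rightarrow>
     (('b \<Rightarrow> 'b \<times> ('y \<Rightarrow> 'z)) \<times> ('b \<Rightarrow> 'b \<times> ('y \<Rightarrow> 'z))) set" where
  "section_rel Y B q Z b0 z0 =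
     {(s, t). s \<in> based_sections Y B q Z b0 z0 \<and> t \<in> based_sections Y B q Z b0 z0 \<and>
        khomotopic_with (is_based_section Y B q Z b0 z0) B (free_range_space Y B q Z) s t}"

definition section_class ::
    "'y topology \<Rightarrow> 'b topology \<Rightarrow> ('y \<Rightarrow> 'b) \<Rightarrow> 'z topology \<Rightarrow> 'b \<Rightarrow> 'z \<Rightarrow>
     ('b \<Rightarrow> 'b \<times> ('y \<Rightarrow> 'z)) \<Rightarrow> ('b \<Rightarrow> 'b \<times> ('y \<Rightarrow> 'z)) set" where
  "section_class Y B q Z b0 z0 s = section_rel Y B q Z b0 z0 `` {s}"

text \<open>The fibrewise multiplication \<open>n\<close>; it is only meant for pairs of points over the same \<open>b\<close>.\<close>

definition fibrewise_mult ::
    "'y topology \<Rightarrow> ('y \<Rightarrow> 'b) \<Rightarrow> ('z \<times> 'z \<Rightarrow> 'z) \<Rightarrow>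
     ('b \<times> ('y \<Rightarrow> 'z)) \<times> ('b \<times> ('y \<Rightarrow> 'z)) \<Rightarrow> 'b \<times> ('y \<Rightarrow> 'z)" where
  "fibrewise_mult Y q m =
     (\<lambda>((b, f), (_, g)). (b, restrict (m \<circ> map_prod f g \<circ> (\<lambda>y. (y, y))) (fibre Y q b)))"

definition section_add ::
    "'y topology \<Rightarrow> 'b topology \<Rightarrow> ('y \<Rightarrow> 'b) \<Rightarrow> ('z \<times> 'z \<Rightarrow> 'z) \<Rightarrow>
     ('b \<Rightarrow> 'b \<times> ('y \<Rightarrow> 'z)) \<Rightarrow> ('b \<Rightarrow> 'b \<times> ('y \<Rightarrow> 'z)) \<Rightarrow> 'b \<Rightarrow> 'b \<times> ('y \<Rightarrow> 'z)" where
  "section_add Y B q m s t = (\<lambda>b\<in>topspace B. fibrewise_mult Y q m (s b, t b))"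

definition section_class_group ::
    "'y topology \<Rightarrow> 'b topology \<Rightarrow> ('y \<Rightarrow> 'b) \<Rightarrow> 'z topology \<Rightarrow> 'b \<Rightarrow> 'z \<Rightarrow> ('z \<times> 'z \<Rightarrow> 'z) \<Rightarrow>
     ('b \<Rightarrow> 'b \<times> ('y \<Rightarrow> 'z)) set monoid" where
  "section_class_group Y B q Z b0 z0 m =
     \<lparr>carrier = based_sections Y B q Z b0 z0 // section_rel Y B q Z b0 z0,
      mult = (\<lambda>c d. \<Union>s\<in>c. \<Union>t\<in>d. section_class Y B q Z b0 z0 (section_add Y B q m s t)),
      one = section_class Y B q Z b0 z0 (\<lambda>b\<in>topspace B. (b, \<lambda>y\<in>fibre Y q b. z0))\<rparr>"

text \<open>The section \<open>\<ell>\<^sup>\<bullet>\<close>.\<close>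

definition bullet ::
    "'y topology \<Rightarrow> 'b topology \<Rightarrow> ('y \<Rightarrow> 'b) \<Rightarrow> ('y \<Rightarrow> 'z) \<Rightarrow> 'b \<Rightarrow> 'b \<times> ('y \<Rightarrow> 'z)" where
  "bullet Y B q l = (\<lambda>b\<in>topspace B. (b, restrict l (fibre Y q b)))"

end

theory Submission
  imports Defs
begin

text \<open>
  The assignment of \<open>\<ell>\<^sup>\<bullet>\<close> to \<open>\<ell>\<close> is a bijection between maps of pairs and based sections that
  commutes strictly with the two additions, so everything reduces to showing that it respects
  continuity, also of homotopies, in both directions. This is an exponential law, checked on compact
  Hausdorff test spaces \<open>C\<close>. If \<open>C \<times> Y \<rightarrow> Z\<close> is continuous, the adjoint \<open>C \<rightarrow> Y!Z\<close> is continuous by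
  the tube lemma: \<open>C \<times> Y\<close> needs no k-ification, and the pairs \<open>(c, y)\<close> with \<open>q y\<close> equal to the base
  point of \<open>c\<close> form a closed set since \<open>B\<close> is weak Hausdorff. Conversely, evaluation along a map
  \<open>C \<rightarrow> Y\<close> is continuous because compact neighbourhoods in \<open>C\<close> have compact images in \<open>Y\<close>.
  The group structure on homotopy classes of pairs comes from substituting maps into the structure
  homotopies of \<open>Z\<close>.
\<close>

section \<open>k-spaces\<close>

lemma continuous_map_from_kify: "continuous_map X Z f \<Longrightarrow> continuous_map (kify X) Z f"
  by (auto simp: continuous_map_def openin_imp_openin_kify)

text \<open>\<open>X\<close> and \<open>kify X\<close> receive the same continuous maps from compact
  Hausdorff spaces, so k-ifying again tests openness against the same maps.\<close>

lemma is_k_space_kify [simp]: "is_k_space (kify X)"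
  unfolding is_k_space_def topology_eq
proof (intro allI iffI)
  fix U assume U: "openin (kify (kify X)) U"
  show "openin (kify X) U"
    unfolding openin_kify[of X]
  proof (intro conjI allI impI)
    show "U \<subseteq> topspace X" using openin_subset[OF U] by simp
    fix C :: "'a set list set set topology" and f
    assume "compact_space C \<and> Hausdorff_space C \<and> continuous_map C X f"
    then show "openin C {c \<in> topspace C. f c \<in> U}"
      using U by (intro openin_kify_test[of C "kify X"]) (auto simp: continuous_map_into_kify)
  qed
qed (rule openin_imp_openin_kify)

text \<open>The universal property of the final topology. It reduces the later continuity proofs to
  compact Hausdorff domains, where the tube lemma and compact neighbourhoods are available.\<close>

lemma continuous_map_from_k_space:
  fixes X :: "'a topology"
  assumes X: "is_k_space X"
    and test: "\<And>(C :: 'a set list set set topology) g.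
      compact_space C \<Longrightarrow> Hausdorff_space C \<Longrightarrow> continuous_map C X g \<Longrightarrow> continuous_map C Y (f \<circ> g)"
  shows "continuous_map X Y f"
  unfolding continuous_map_def
proof (intro conjI allI impI)
  show "f \<in> topspace X \<rightarrow> topspace Y"
  proof
    fix x assume x: "x \<in> topspace X"
    \<comment> \<open>The map from a one-point test space that picks out \<open>x\<close> lets
      \<open>test\<close> control the value \<open>f x\<close> as well.\<close>
    have "continuous_map (discrete_topology {{} :: 'a set list set set}) Y (f \<circ> (\<lambda>_. x))"
      by (rule test) (use x in \<open>auto simp: compact_space_discrete_topology\<close>)
    from continuous_map_image_subset_topspace[OF this] show "f x \<in> topspace Y"
      by auto
  qed
  fix U assume U: "openin Y U"
  have "openin (kify X) {x \<in> topspace X. f x \<in> U}"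
    unfolding openin_kify
  proof (intro conjI allI impI)
    fix C :: "'a set list set set topology" and g
    assume C: "compact_space C \<and> Hausdorff_space C \<and> continuous_map C X g"
    then have "openin C {c \<in> topspace C. (f \<circ> g) c \<in> U}"
      using test U by (blast intro: openin_continuous_map_preimage)
    moreover have "{c \<in> topspace C. (f \<circ> g) c \<in> U} = {c \<in> topspace C. g c \<in> {x \<in> topspace X. f x \<in> U}}"
      using C by (auto simp: continuous_map_def)
    ultimately show "openin C {c \<in> topspace C. g c \<in> {x \<in> topspace X. f x \<in> U}}"
      by simp
  qed auto
  then show "openin X {x \<in> topspace X. f x \<in> U}"
    using X by (simp add: is_k_space_def)
qed

text \<open>k-ification is a coreflection: every test map of \<open>X\<close>, followed by
  \<open>f\<close>, lifts to \<open>kify Y\<close>.\<close>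

lemma continuous_map_k_space_into_kify:
  assumes X: "is_k_space X" and f: "continuous_map X Y f"
  shows "continuous_map X (kify Y) f"
  by (rule continuous_map_from_k_space[OF X])
    (simp add: continuous_map_into_kify continuous_map_compose[OF _ f])

section \<open>Products in the category of k-spaces\<close>

lemma is_k_space_kprod [simp]: "is_k_space (kprod X Y)"
  by (simp add: kprod_def)

lemma topspace_kprod [simp]: "topspace (kprod X Y) = topspace X \<times> topspace Y"
  by (simp add: kprod_def)

lemma continuous_map_kprod_fst: "continuous_map (kprod X Y) X fst"
  and continuous_map_kprod_snd: "continuous_map (kprod X Y) Y snd"
  unfolding kprod_def
  by (auto intro: continuous_map_from_kify continuous_map_fst continuous_map_snd)

lemma continuous_map_into_kprod:
  assumes "is_k_space X" "continuous_map X Y f" "continuous_map X Z g"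
  shows "continuous_map X (kprod Y Z) (\<lambda>x. (f x, g x))"
  unfolding kprod_def
  using assms by (intro continuous_map_k_space_into_kify) (auto simp: continuous_map_pairedI)

text \<open>Around a point of a k-open set \<open>W\<close>, a compact neighbourhood inside one
  slice over \<open>C\<close> thickens to a product neighbourhood. This makes the tube lemma
  applicable to open sets of \<open>kprod C Y\<close>.\<close>

lemma kprod_compact_Hausdorff:
  assumes C: "compact_space C" "Hausdorff_space C" and Y: "is_k_space Y"
  shows "kprod C Y = prod_topology C Y"
proof -
  have "openin (prod_topology C Y) W" if W: "openin (kprod C Y) W" for W
    unfolding openin_prod_topology_alt
  proof (intro allI impI)
    fix c0 y0 assume cy: "(c0, y0) \<in> W"
    have sub: "W \<subseteq> topspace C \<times> topspace Y"
      using openin_subset[OF W] by simp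
    have "continuous_map C (prod_topology C Y) (\<lambda>c. (c, y0))"
      using cy sub by (intro continuous_map_pairedI) auto
    then have "openin C {c \<in> topspace C. (c, y0) \<in> W}"
      using W unfolding kprod_def by (rule openin_kify_test[OF C])
    moreover have "neighbourhood_base_of (compactin C) C"
      using C by (simp add: compact_imp_locally_compact_space compact_Hausdorff_imp_regular_space
          locally_compact_imp_neighbourhood_base)
    moreover have "c0 \<in> {c \<in> topspace C. (c, y0) \<in> W}"
      using cy sub by auto
    ultimately obtain T N where N: "openin C T" "compactin C N" "c0 \<in> T" "T \<subseteq> N"
      "N \<subseteq> {c \<in> topspace C. (c, y0) \<in> W}"
      unfolding neighbourhood_base_of by meson
    \<comment> \<open>\<open>V\<close> is the largest set with
      \<open>N \<times> V \<subseteq> W\<close>. Since \<open>Y\<close> is a k-space, its openness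
      can be checked along maps \<open>f\<close> from compact Hausdorff spaces
      \<open>D\<close>.\<close>
    define V where "V = {y \<in> topspace Y. N \<times> {y} \<subseteq> W}"
    have "openin (kify Y) V"
      unfolding openin_kify
    proof (intro conjI allI impI)
      fix D :: "'b set list set set topology" and f
      assume D: "compact_space D \<and> Hausdorff_space D \<and> continuous_map D Y f"
      let ?W = "{p \<in> topspace (prod_topology C D). (fst p, f (snd p)) \<in> W}"
      have "continuous_map (prod_topology C D) (prod_topology C Y) (\<lambda>p. (fst p, f (snd p)))"
        using continuous_map_compose[OF continuous_map_snd[of C D], of Y f] D
        by (intro continuous_map_pairedI continuous_map_fst) (simp add: comp_def)
      \<comment> \<open>\<open>C \<times> D\<close> is again compact Hausdorff, so the k-open set
        \<open>W\<close> pulls back to an open set of the ordinary product. Its type is not that of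
        the test spaces, which \<open>openin_kify_test\<close> allows.\<close>
      then have W': "openin (prod_topology C D) ?W"
        using C D W unfolding kprod_def
        by (intro openin_kify_test) (auto simp: compact_space_prod_topology Hausdorff_space_prod_topology)
      show "openin D {d \<in> topspace D. f d \<in> V}"
      proof (subst openin_subopen, intro ballI)
        fix d assume d: "d \<in> {d \<in> topspace D. f d \<in> V}"
        then have "N \<times> {d} \<subseteq> ?W"
          using compactin_subset_topspace[OF N(2)] by (auto simp: V_def)
        moreover have "d \<in> topspace D" using d by simp
        ultimately obtain P Q where PQ: "openin C P" "openin D Q" "N \<subseteq> P" "d \<in> Q" "P \<times> Q \<subseteq> ?W"
          using tube_lemma_left[OF W' N(2)] by meson
        have "Q \<subseteq> {d \<in> topspace D. f d \<in> V}"
        proof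
          fix x assume x: "x \<in> Q"
          then have "x \<in> topspace D" using PQ openin_subset by blast
          moreover have "(a, f x) \<in> W" if "a \<in> N" for a
            using PQ(3,5) x that by force
          ultimately show "x \<in> {d \<in> topspace D. f d \<in> V}"
            using D by (auto simp: V_def continuous_map_def)
        qed
        then show "\<exists>T. openin D T \<and> d \<in> T \<and> T \<subseteq> {d \<in> topspace D. f d \<in> V}"
          using PQ by blast
      qed
    qed (auto simp: V_def)
    then have "openin Y V" using Y by (simp add: is_k_space_def)
    moreover have "y0 \<in> V" using N cy sub by (auto simp: V_def)
    moreover have "T \<times> V \<subseteq> W" using N by (auto simp: V_def)
    ultimately show "\<exists>U V. openin C U \<and> openin Y V \<and> c0 \<in> U \<and> y0 \<in> V \<and> U \<times> V \<subseteq> W"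
      using N by blast
  qed
  then show ?thesis
    by (auto simp: topology_eq kprod_def openin_imp_openin_kify)
qed

text \<open>The preimage of \<open>A\<close> in a test space is closed, hence itself compact
  Hausdorff, so a test map of \<open>Y\<close> restricts to a test map of the subspace. Applied to
  closed fibres, it makes the k-ification in \<open>fibre_space\<close> harmless.\<close>

lemma is_k_space_closed_subspace:
  assumes Y: "is_k_space Y" and A: "closedin Y A"
  shows "is_k_space (subtopology Y A)"
proof -
  have "closedin (subtopology Y A) S" if S: "closedin (kify (subtopology Y A)) S" for S
  proof -
    have SA: "S \<subseteq> A" using closedin_subset[OF S] by auto
    have "openin (kify Y) (topspace Y - S)"
      unfolding openin_kify
    proof (intro conjI allI impI)
      fix C :: "'a set list set set topology" and f
      assume C: "compact_space C \<and> Hausdorff_space C \<and> continuous_map C Y f"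
      let ?D = "{c \<in> topspace C. f c \<in> A}"
      have D: "closedin C ?D" using C A by (blast intro: closedin_continuous_map_preimage)
      have "continuous_map (subtopology C ?D) (subtopology Y A) f"
        using C by (auto simp: continuous_map_in_subtopology continuous_map_from_subtopology)
      moreover have "compact_space (subtopology C ?D)" "Hausdorff_space (subtopology C ?D)"
        using C D by (auto simp: closedin_compact_space compact_space_subtopology Hausdorff_space_subtopology)
      ultimately have "continuous_map (subtopology C ?D) (kify (subtopology Y A)) f"
        by (simp add: continuous_map_into_kify)
      then have "closedin (subtopology C ?D) {c \<in> topspace (subtopology C ?D). f c \<in> S}"
        using S by (rule closedin_continuous_map_preimage)
      then have "closedin C {c \<in> topspace (subtopology C ?D). f c \<in> S}"
        using D by (rule closedin_trans_full)
      moreover have "{c \<in> topspace C. f c \<in> topspace Y - S} =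
          topspace C - {c \<in> topspace (subtopology C ?D). f c \<in> S}"
        using C SA by (auto simp: continuous_map_def)
      ultimately show "openin C {c \<in> topspace C. f c \<in> topspace Y - S}"
        by auto
    qed auto
    then have "closedin Y S"
      using Y SA closedin_subset[OF A] by (auto simp: is_k_space_def closedin_def)
    then show ?thesis using SA by (simp add: closedin_subset_topspace)
  qed
  then have "openin (subtopology Y A) U" if "openin (kify (subtopology Y A)) U" for U
    using that by (metis openin_closedin_eq topspace_kify)
  then show ?thesis
    by (auto simp: is_k_space_def topology_eq openin_imp_openin_kify)
qed

section \<open>The exponential law for free range mapping spaces\<close>

lemma topspace_fibre_space [simp]: "topspace (fibre_space Y q b) = fibre Y q b"
  by (auto simp: fibre_space_def fibre_def)

text \<open>The fibre is the preimage of the diagonal under \<open>y \<mapsto> (q y, b)\<close>.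
  This map is continuous into the k-ified square of \<open>B\<close> because \<open>Y\<close> is a
  k-space.\<close>

lemma closedin_fibre:
  assumes Y: "is_k_space Y" and B: "weak_Hausdorff B" and q: "continuous_map Y B q"
    and b: "b \<in> topspace B"
  shows "closedin Y (fibre Y q b)"
proof -
  have "continuous_map Y (kprod B B) (\<lambda>y. (q y, b))"
    using Y q b by (intro continuous_map_into_kprod) auto
  then have "closedin Y {y \<in> topspace Y. (q y, b) \<in> (\<lambda>b. (b, b)) ` topspace B}"
    using B unfolding weak_Hausdorff_def by (rule closedin_continuous_map_preimage)
  moreover have "{y \<in> topspace Y. (q y, b) \<in> (\<lambda>b. (b, b)) ` topspace B} = fibre Y q b"
    using b by (auto simp: fibre_def)
  ultimately show ?thesis by simp
qed

lemma topspace_free_range_space [simp]: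
  "topspace (free_range_space Y B q Z) = free_range_maps Y B q Z"
proof -
  have "free_range_maps Y B q Z = {u \<in> free_range_maps Y B q Z. free_range_proj u \<in> topspace B}"
    by (auto simp: free_range_maps_def free_range_proj_def)
  then show ?thesis
    unfolding free_range_space_def topspace_kify topology_generated_by_topspace
    by blast
qed

lemma topspace_compact_open [simp]: "topspace (compact_open X Z) = maps X Z"
proof -
  \<comment> \<open>Taking the empty compact set shows that the subbasis has all of
    \<open>maps X Z\<close> as a member.\<close>
  have "maps X Z = {f \<in> maps X Z. f ` {} \<subseteq> topspace Z}" by simp
  then show ?thesis
    unfolding compact_open_def topology_generated_by_topspace
    by (auto intro!: exI[of _ "{}"] exI[of _ "topspace Z"])
qed

text \<open>A closed set of \<open>tilde Z\<close> other than the whole space is a closed set of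
  \<open>Z\<close>. Its preimage is closed in the fibre, hence in \<open>Y\<close>, because the
  fibre is closed.\<close>

lemma free_range_incl_in_maps:
  assumes Y: "is_k_space Y" and B: "weak_Hausdorff B" and q: "continuous_map Y B q"
    and u: "u \<in> free_range_maps Y B q Z"
  shows "free_range_incl Y q u \<in> maps Y (tilde Z)"
proof -
  obtain b f where bf: "u = (b, f)" and b: "b \<in> topspace B"
    and f: "continuous_map (fibre_space Y q b) Z f"
    using u by (auto simp: free_range_maps_def maps_def)
  let ?i = "free_range_incl Y q (b, f)"
  have A: "closedin Y (fibre Y q b)" using Y B q b by (rule closedin_fibre)
  have val: "?i y = (if y \<in> fibre Y q b then Some (f y) else None)" if "y \<in> topspace Y" for y
    using that by (simp add: free_range_incl_def)
  have "continuous_map Y (tilde Z) ?i"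
    unfolding continuous_map_closedin
  proof (intro conjI allI ballI impI)
    show i: "?i \<in> topspace Y \<rightarrow> topspace (tilde Z)"
      using f by (auto simp: val topspace_tilde continuous_map_def Pi_iff)
    fix F assume "closedin (tilde Z) F"
    then consider "F = topspace (tilde Z)" | S where "closedin Z S" "F = Some ` S"
      unfolding closedin_tilde by blast
    then show "closedin Y {y \<in> topspace Y. ?i y \<in> F}"
    proof cases
      case 1
      then have "{y \<in> topspace Y. ?i y \<in> F} = topspace Y" using i by blast
      then show ?thesis by simp
    next
      case (2 S)
      then have "{y \<in> topspace Y. ?i y \<in> F} = {y \<in> topspace (fibre_space Y q b). f y \<in> S}"
        using val by (auto simp: fibre_def split: if_splits)
      moreover have "fibre_space Y q b = subtopology Y (fibre Y q b)"
        using is_k_space_closed_subspace[OF Y A] by (simp add: fibre_space_def is_k_space_def)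
      ultimately show ?thesis
        using closedin_continuous_map_preimage[OF f 2(1)] A closedin_trans_full by metis
    qed
  qed
  then show ?thesis by (auto simp: bf maps_def free_range_incl_def)
qed

text \<open>One half of the exponential law, over a test space. The initial topology leaves two maps
  to check: the projection is \<beta>, and the composite with \<open>free_range_incl\<close> is
  handled on the compact-open subbasis.\<close>

lemma continuous_map_into_free_range_space_compact:
  assumes C: "compact_space C" "Hausdorff_space C"
    and Y: "is_k_space Y" and B: "weak_Hausdorff B" and q: "continuous_map Y B q"
    and \<beta>: "continuous_map C B \<beta>" and h: "continuous_map (kprod C Y) Z h"
  shows "continuous_map C (free_range_space Y B q Z) (\<lambda>c. (\<beta> c, \<lambda>y\<in>fibre Y q (\<beta> c). h (c, y)))"
    (is "continuous_map C _ ?s")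
proof -
  have hc: "continuous_map Y Z (\<lambda>y. h (c, y))" if "c \<in> topspace C" for c
    using that Y by (intro continuous_map_compose[OF _ h, unfolded comp_def] continuous_map_into_kprod) auto
  have \<beta>in: "\<beta> c \<in> topspace B" if "c \<in> topspace C" for c
    using \<beta> that by (auto simp: continuous_map_def)
  have s: "?s c \<in> free_range_maps Y B q Z" if "c \<in> topspace C" for c
    using that \<beta>in unfolding free_range_maps_def maps_def fibre_space_def
    by (auto simp: fibre_def intro!: continuous_map_from_kify
        intro: continuous_map_eq[OF continuous_map_from_subtopology[OF hc[OF that]]])
  have "continuous_map C (compact_open Y (tilde Z)) (\<lambda>c. free_range_incl Y q (?s c))"
    (is "continuous_map C _ ?i")
    unfolding compact_open_def
  proof (rule continuous_on_generated_topo)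
    have i: "?i c \<in> maps Y (tilde Z)" if "c \<in> topspace C" for c
      using free_range_incl_in_maps[OF Y B q s[OF that]] .
    then show "?i ` topspace C \<subseteq>
        \<Union> {{f \<in> maps Y (tilde Z). f ` K \<subseteq> U} |K U. compactin Y K \<and> openin (tilde Z) U}"
      using topspace_compact_open[of Y "tilde Z"]
      unfolding compact_open_def topology_generated_by_topspace by blast
    fix W assume "W \<in> {{f \<in> maps Y (tilde Z). f ` K \<subseteq> U} |K U. compactin Y K \<and> openin (tilde Z) U}"
    then obtain K U where K: "compactin Y K" and U: "openin (tilde Z) U"
      and W: "W = {f \<in> maps Y (tilde Z). f ` K \<subseteq> U}" by blast
    have KY: "K \<subseteq> topspace Y" using K by (rule compactin_subset_topspace)
    have eq: "?i -` W \<inter> topspace C = {c \<in> topspace C. \<forall>y\<in>K. ?i c y \<in> U}"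
      using i by (auto simp: W)
    show "openin C (?i -` W \<inter> topspace C)"
    \<comment> \<open>The empty set is the only open set of \<open>tilde Z\<close> that misses
      \<open>None\<close>. For it the condition holds for all \<open>c\<close> if \<open>K\<close>
      is empty and for none otherwise.\<close>
    proof (cases "U = {}")
      case True
      then show ?thesis unfolding eq by (cases "K = {}") auto
    next
      case False
      then obtain V where V: "openin Z V" "U = insert None (Some ` V)"
        using U unfolding openin_tilde by blast
      \<comment> \<open>Points \<open>y\<close> off the fibre over \<open>\<beta> c\<close> have
        value \<open>None\<close>, which lies in \<open>U\<close>, so only points with
        \<open>q y = \<beta> c\<close> impose a condition. The first set is open because it is the
        complement of the preimage of the closed diagonal of \<open>B\<close>.\<close>
      define G where "G = {p \<in> topspace (kprod C Y). \<beta> (fst p) \<noteq> q (snd p)} \<union>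
        {p \<in> topspace (kprod C Y). h p \<in> V}"
      have "continuous_map (kprod C Y) (kprod B B) (\<lambda>p. (\<beta> (fst p), q (snd p)))"
        using continuous_map_compose[OF continuous_map_kprod_fst \<beta>]
          continuous_map_compose[OF continuous_map_kprod_snd q]
        by (intro continuous_map_into_kprod) (simp_all add: comp_def)
      then have "closedin (kprod C Y) {p \<in> topspace (kprod C Y).
          (\<beta> (fst p), q (snd p)) \<in> (\<lambda>b. (b, b)) ` topspace B}"
        using B unfolding weak_Hausdorff_def by (rule closedin_continuous_map_preimage)
      then have "openin (kprod C Y) (topspace (kprod C Y) - {p \<in> topspace (kprod C Y).
          (\<beta> (fst p), q (snd p)) \<in> (\<lambda>b. (b, b)) ` topspace B})"
        by blast
      moreover have "topspace (kprod C Y) - {p \<in> topspace (kprod C Y).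
          (\<beta> (fst p), q (snd p)) \<in> (\<lambda>b. (b, b)) ` topspace B}
          = {p \<in> topspace (kprod C Y). \<beta> (fst p) \<noteq> q (snd p)}"
        using \<beta>in by (force simp: image_iff)
      ultimately have "openin (kprod C Y) G"
        unfolding G_def using openin_continuous_map_preimage[OF h V(1)] by auto
      then have G: "openin (prod_topology C Y) G"
        using kprod_compact_Hausdorff[OF C Y] by simp
      have iU: "?i c y \<in> U \<longleftrightarrow> (c, y) \<in> G" if "c \<in> topspace C" "y \<in> topspace Y" for c y
        using that by (auto simp: free_range_incl_def fibre_def G_def V)
      show ?thesis
        unfolding eq
      proof (subst openin_subopen, intro ballI)
        fix c assume "c \<in> {c \<in> topspace C. \<forall>y\<in>K. ?i c y \<in> U}"
        then have c: "c \<in> topspace C" "{c} \<times> K \<subseteq> G" using iU KY by auto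
        then obtain P Q where PQ: "openin C P" "openin Y Q" "c \<in> P" "K \<subseteq> Q" "P \<times> Q \<subseteq> G"
          \<comment> \<open>All of \<open>{c} \<times> K\<close> lies in the open set
            \<open>G\<close>, so a neighbourhood \<open>P\<close> of \<open>c\<close> satisfies the
            condition for every \<open>y\<close> in \<open>K\<close> at once.\<close>
          using tube_lemma_right[OF G K] by meson
        then have "P \<subseteq> {c \<in> topspace C. \<forall>y\<in>K. ?i c y \<in> U}"
          using iU KY openin_subset[OF PQ(1)] by blast
        then show "\<exists>T. openin C T \<and> c \<in> T \<and> T \<subseteq> {c \<in> topspace C. \<forall>y\<in>K. ?i c y \<in> U}"
          using PQ by blast
      qed
    qed
  qed
  \<comment> \<open>k-ifying the target changes nothing for maps out of the compact Hausdorff space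
    \<open>C\<close>.\<close>
  then have i: "continuous_map C (mapping_space Y (tilde Z)) ?i"
    unfolding mapping_space_def by (simp add: continuous_map_into_kify[OF C])
  show ?thesis
    unfolding free_range_space_def continuous_map_into_kify[OF C]
  proof (rule continuous_on_generated_topo)
    show "?s ` topspace C \<subseteq> \<Union> ({{u \<in> free_range_maps Y B q Z. free_range_incl Y q u \<in> U} | U.
          openin (mapping_space Y (tilde Z)) U} \<union>
      {{u \<in> free_range_maps Y B q Z. free_range_proj u \<in> V} | V. openin B V})"
      using s topspace_free_range_space[of Y B q Z]
      unfolding free_range_space_def topspace_kify topology_generated_by_topspace by blast
    fix W assume "W \<in> {{u \<in> free_range_maps Y B q Z. free_range_incl Y q u \<in> U} | U.
          openin (mapping_space Y (tilde Z)) U} \<union>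
      {{u \<in> free_range_maps Y B q Z. free_range_proj u \<in> V} | V. openin B V}"
    then consider U where "openin (mapping_space Y (tilde Z)) U"
        "W = {u \<in> free_range_maps Y B q Z. free_range_incl Y q u \<in> U}"
      | V where "openin B V" "W = {u \<in> free_range_maps Y B q Z. free_range_proj u \<in> V}"
      by blast
    then show "openin C (?s -` W \<inter> topspace C)"
    proof cases
      case (1 U)
      then have "?s -` W \<inter> topspace C = {c \<in> topspace C. ?i c \<in> U}" using s by auto
      then show ?thesis using openin_continuous_map_preimage[OF i 1(1)] by simp
    next
      case (2 V)
      then have "?s -` W \<inter> topspace C = {c \<in> topspace C. \<beta> c \<in> V}"
        using s by (auto simp: free_range_proj_def)
      then show ?thesis using openin_continuous_map_preimage[OF \<beta> 2(1)] by simp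
    qed
  qed
qed

text \<open>Along a test map \<open>g\<close> of \<open>X\<close>, the function \<open>h\<close>
  pulls back to \<open>kprod C Y\<close> through \<open>g\<close> times the identity, which reduces
  the claim to the compact Hausdorff case.\<close>

proposition continuous_map_into_free_range_space:
  assumes X: "is_k_space X" and Y: "is_k_space Y" and B: "weak_Hausdorff B"
    and q: "continuous_map Y B q" and \<beta>: "continuous_map X B \<beta>" and h: "continuous_map (kprod X Y) Z h"
  shows "continuous_map X (free_range_space Y B q Z) (\<lambda>x. (\<beta> x, \<lambda>y\<in>fibre Y q (\<beta> x). h (x, y)))"
proof (rule continuous_map_from_k_space[OF X])
  fix C :: "'a set list set set topology" and g
  assume C: "compact_space C" "Hausdorff_space C" and g: "continuous_map C X g"
  have "continuous_map (kprod C Y) (kprod X Y) (\<lambda>p. (g (fst p), snd p))"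
    using continuous_map_compose[OF continuous_map_kprod_fst g]
    by (intro continuous_map_into_kprod continuous_map_kprod_snd) (simp_all add: comp_def)
  then have "continuous_map (kprod C Y) Z (h \<circ> (\<lambda>p. (g (fst p), snd p)))"
    using h by (rule continuous_map_compose)
  from continuous_map_into_free_range_space_compact
    [OF C Y B q continuous_map_compose[OF g \<beta>] this]
  show "continuous_map C (free_range_space Y B q Z)
      ((\<lambda>x. (\<beta> x, \<lambda>y\<in>fibre Y q (\<beta> x). h (x, y))) \<circ> g)"
    by (simp add: comp_def)
qed

text \<open>The other half of the exponential law: evaluation on the fibre product of
  \<open>Y!Z\<close> and \<open>Y\<close> over \<open>B\<close>, stated along a map
  \<open>x \<mapsto> (g x, a x)\<close> so that no topology on the fibre product has to be
  named.\<close>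

proposition continuous_map_free_range_eval:
  fixes X :: "'a topology"
  assumes X: "is_k_space X" and Y: "is_k_space Y" and B: "weak_Hausdorff B"
    and q: "continuous_map Y B q" and a: "continuous_map X Y a"
    and g: "continuous_map X (free_range_space Y B q Z) g"
    and ga: "\<And>x. x \<in> topspace X \<Longrightarrow> fst (g x) = q (a x)"
  shows "continuous_map X Z (\<lambda>x. snd (g x) (a x))"
proof (rule continuous_map_from_k_space[OF X])
  fix C :: "'a set list set set topology" and c
  assume C: "compact_space C" "Hausdorff_space C" and c: "continuous_map C X c"
  have cX: "c x \<in> topspace X" if "x \<in> topspace C" for x
    using c that by (auto simp: continuous_map_def)
  have ac: "continuous_map C Y (a \<circ> c)" using c a by (rule continuous_map_compose)
  then have acY: "a (c x) \<in> topspace Y" if "x \<in> topspace C" for x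
    using that by (auto simp: continuous_map_def)
  have gm: "g (c x) \<in> free_range_maps Y B q Z" if "x \<in> topspace C" for x
    using g cX[OF that] by (auto simp: continuous_map_def)
  define \<phi> where "\<phi> = (\<lambda>x. free_range_incl Y q (g (c x)))"
  have \<phi>val: "\<phi> x (a (c x)) = Some (snd (g (c x)) (a (c x)))" if "x \<in> topspace C" for x
    using ga[OF cX[OF that]] acY[OF that]
    by (auto simp: \<phi>_def free_range_incl_def fibre_def split: prod.splits)
  have \<phi>open: "openin C {x \<in> topspace C. \<phi> x \<in> U}" if U: "openin (compact_open Y (tilde Z)) U" for U
  proof -
    have "openin (free_range_space Y B q Z) {u \<in> free_range_maps Y B q Z. free_range_incl Y q u \<in> U}"
      unfolding free_range_space_def mapping_space_def using U openin_imp_openin_kify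
      by (intro openin_imp_openin_kify topology_generated_by_Basis) blast
    then have "openin C {x \<in> topspace C. (g \<circ> c) x \<in>
        {u \<in> free_range_maps Y B q Z. free_range_incl Y q u \<in> U}}"
      using continuous_map_compose[OF c g] by (rule openin_continuous_map_preimage[rotated])
    moreover have "{x \<in> topspace C. (g \<circ> c) x \<in> {u \<in> free_range_maps Y B q Z. free_range_incl Y q u \<in> U}}
        = {x \<in> topspace C. \<phi> x \<in> U}"
      using gm by (auto simp: \<phi>_def)
    ultimately show ?thesis by simp
  qed
  show "continuous_map C Z ((\<lambda>x. snd (g x) (a x)) \<circ> c)"
    unfolding continuous_map_def
  proof (intro conjI allI impI)
    show "(\<lambda>x. snd (g x) (a x)) \<circ> c \<in> topspace C \<rightarrow> topspace Z"
    proof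
      fix x assume x: "x \<in> topspace C"
      obtain b f where bf: "g (c x) = (b, f)" by force
      have "continuous_map (fibre_space Y q b) Z f"
        using gm[OF x] by (auto simp: bf free_range_maps_def maps_def)
      moreover have "a (c x) \<in> topspace (fibre_space Y q b)"
        using ga[OF cX[OF x]] acY[OF x] by (simp add: bf fibre_def)
      ultimately show "((\<lambda>x. snd (g x) (a x)) \<circ> c) x \<in> topspace Z"
        by (auto simp: bf continuous_map_def)
    qed
    fix V assume V: "openin Z V"
    let ?U = "insert None (Some ` V)"
    have U: "openin (tilde Z) ?U" using V openin_tilde by blast
    show "openin C {x \<in> topspace C. ((\<lambda>x. snd (g x) (a x)) \<circ> c) x \<in> V}"
    proof (subst openin_subopen, intro ballI)
      fix x assume "x \<in> {x \<in> topspace C. ((\<lambda>x. snd (g x) (a x)) \<circ> c) x \<in> V}"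
      then have x: "x \<in> topspace C" "snd (g (c x)) (a (c x)) \<in> V" by auto
      have \<phi>x: "\<phi> x \<in> maps Y (tilde Z)" if "x \<in> topspace C" for x
        using free_range_incl_in_maps[OF Y B q gm[OF that]] by (simp add: \<phi>_def)
      \<comment> \<open>First the map \<open>\<phi> x\<close> is frozen and only its argument moves.
        This yields a compact neighbourhood \<open>N\<close> of \<open>x\<close> whose image in
        \<open>Y\<close> is sent into \<open>?U\<close> by \<open>\<phi> x\<close>.\<close>
      have "continuous_map C (tilde Z) (\<phi> x \<circ> (a \<circ> c))"
        using ac \<phi>x[OF x(1)] by (auto simp: maps_def intro: continuous_map_compose)
      then have "openin C {d \<in> topspace C. (\<phi> x \<circ> (a \<circ> c)) d \<in> ?U}"
        using U by (rule openin_continuous_map_preimage)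
      moreover have "neighbourhood_base_of (compactin C) C"
        using C by (simp add: compact_imp_locally_compact_space compact_Hausdorff_imp_regular_space
            locally_compact_imp_neighbourhood_base)
      moreover have "x \<in> {d \<in> topspace C. (\<phi> x \<circ> (a \<circ> c)) d \<in> ?U}"
        using x \<phi>val by auto
      ultimately obtain T N where N: "openin C T" "compactin C N" "x \<in> T" "T \<subseteq> N"
        "N \<subseteq> {d \<in> topspace C. (\<phi> x \<circ> (a \<circ> c)) d \<in> ?U}"
        unfolding neighbourhood_base_of by meson
      let ?K = "(a \<circ> c) ` N"
      \<comment> \<open>Now the map moves too: near \<open>x\<close>, every \<open>\<phi> d\<close>
        still sends the compact set \<open>?K\<close> into \<open>?U\<close>, and for
        \<open>d\<close> in \<open>T\<close> the point \<open>a (c d)\<close> lies in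
        \<open>?K\<close>.\<close>
      let ?P = "{f \<in> maps Y (tilde Z). f ` ?K \<subseteq> ?U}"
      have "compactin Y ?K" using N(2) ac by (rule image_compactin)
      then have "openin (compact_open Y (tilde Z)) ?P"
        unfolding compact_open_def using U by (intro topology_generated_by_Basis) blast
      then have "openin C (T \<inter> {d \<in> topspace C. \<phi> d \<in> ?P})"
        using N(1) \<phi>open by blast
      moreover have "x \<in> T \<inter> {d \<in> topspace C. \<phi> d \<in> ?P}"
        using N x \<phi>x by auto
      moreover have "T \<inter> {d \<in> topspace C. \<phi> d \<in> ?P} \<subseteq>
          {x \<in> topspace C. ((\<lambda>x. snd (g x) (a x)) \<circ> c) x \<in> V}"
      proof
        fix d assume d: "d \<in> T \<inter> {d \<in> topspace C. \<phi> d \<in> ?P}"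
        then have "\<phi> d (a (c d)) \<in> ?U" using N(4) by auto
        then show "d \<in> {x \<in> topspace C. ((\<lambda>x. snd (g x) (a x)) \<circ> c) x \<in> V}"
          using d \<phi>val by auto
      qed
      ultimately show "\<exists>T. openin C T \<and> x \<in> T \<and>
          T \<subseteq> {x \<in> topspace C. ((\<lambda>x. snd (g x) (a x)) \<circ> c) x \<in> V}"
        by blast
    qed
  qed
qed

section \<open>Homotopies of maps of pairs\<close>

text \<open>Substitution in the space and reparametrisation of time, as used for reversing,
  concatenating and precomposing homotopies.\<close>

lemma continuous_map_kprod_interval:
  assumes "continuous_map X Y f" "continuous_on {0..1} r" "r ` {0..1} \<subseteq> {0..1::real}"
  shows "continuous_map (kprod X (top_of_set {0..1})) (kprod Y (top_of_set {0..1})) (\<lambda>p. (f (fst p), r (snd p)))"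
proof (rule continuous_map_into_kprod)
  show "continuous_map (kprod X (top_of_set {0..1})) Y (\<lambda>p. f (fst p))"
    using continuous_map_compose[OF continuous_map_kprod_fst assms(1)] by (simp add: comp_def)
  have "continuous_map (top_of_set {0..1}) (top_of_set {0..1}) r"
    using assms(2,3) by (auto simp: continuous_map_in_subtopology)
  from continuous_map_compose[OF continuous_map_kprod_snd this]
  show "continuous_map (kprod X (top_of_set {0..1})) (top_of_set {0..1}) (\<lambda>p. r (snd p))"
    by (simp add: comp_def)
qed simp

lemma continuous_map_kprod_slice:
  assumes "is_k_space X" "continuous_map (kprod X T) Z h" "t \<in> topspace T"
  shows "continuous_map X Z (\<lambda>x. h (x, t))"
  using assms by (intro continuous_map_compose[OF _ assms(2), unfolded comp_def] continuous_map_into_kprod) auto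

lemma pair_homotopicE:
  assumes "pair_homotopic X A Z D f g"
  obtains h where "continuous_map (kprod X (top_of_set {0..1::real})) Z h"
    "\<And>x. x \<in> topspace X \<Longrightarrow> h (x, 0) = f x" "\<And>x. x \<in> topspace X \<Longrightarrow> h (x, 1) = g x"
    "\<And>x t. x \<in> A \<Longrightarrow> t \<in> {0..1} \<Longrightarrow> h (x, t) \<in> D"
  using assms unfolding pair_homotopic_def khomotopic_with_def by blast

lemma pair_homotopicI:
  assumes "continuous_map (kprod X (top_of_set {0..1::real})) Z h"
    "\<And>x. x \<in> topspace X \<Longrightarrow> h (x, 0) = f x" "\<And>x. x \<in> topspace X \<Longrightarrow> h (x, 1) = g x"
    "\<And>x t. x \<in> A \<Longrightarrow> t \<in> {0..1} \<Longrightarrow> h (x, t) \<in> D"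
  shows "pair_homotopic X A Z D f g"
  using assms unfolding pair_homotopic_def khomotopic_with_def by blast

section \<open>Homotopy of maps of pairs: equivalence relation and composition\<close>

lemma pair_homotopic_refl:
  assumes "continuous_map X Z f" "f ` A \<subseteq> D"
  shows "pair_homotopic X A Z D f f"
proof (rule pair_homotopicI)
  show "continuous_map (kprod X (top_of_set {0..1::real})) Z (\<lambda>p. f (fst p))"
    using continuous_map_compose[OF continuous_map_kprod_fst assms(1)] by (simp add: comp_def)
qed (use assms in auto)

lemma pair_homotopic_sym:
  assumes "pair_homotopic X A Z D f g"
  shows "pair_homotopic X A Z D g f"
proof -
  obtain h where h: "continuous_map (kprod X (top_of_set {0..1::real})) Z h"
    "\<And>x. x \<in> topspace X \<Longrightarrow> h (x, 0) = f x" "\<And>x. x \<in> topspace X \<Longrightarrow> h (x, 1) = g x"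
    "\<And>x t. x \<in> A \<Longrightarrow> t \<in> {0..1} \<Longrightarrow> h (x, t) \<in> D"
    using assms by (rule pair_homotopicE) blast
  have "continuous_map (kprod X (top_of_set {0..1})) (kprod X (top_of_set {0..1::real}))
      (\<lambda>p. (fst p, 1 - snd p))"
    by (rule continuous_map_kprod_interval) (auto intro!: continuous_intros)
  from continuous_map_compose[OF this h(1)] show ?thesis
    by (rule pair_homotopicI) (use h in auto)
qed

lemma pair_homotopic_trans:
  assumes "pair_homotopic X A Z D f g" "pair_homotopic X A Z D g k"
  shows "pair_homotopic X A Z D f k"
proof -
  let ?I = "top_of_set {0..1::real}"
  obtain h where h: "continuous_map (kprod X ?I) Z h"
    "\<And>x. x \<in> topspace X \<Longrightarrow> h (x, 0) = f x" "\<And>x. x \<in> topspace X \<Longrightarrow> h (x, 1) = g x"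
    "\<And>x t. x \<in> A \<Longrightarrow> t \<in> {0..1} \<Longrightarrow> h (x, t) \<in> D"
    using assms(1) by (rule pair_homotopicE) blast
  obtain h' where h': "continuous_map (kprod X ?I) Z h'"
    "\<And>x. x \<in> topspace X \<Longrightarrow> h' (x, 0) = g x" "\<And>x. x \<in> topspace X \<Longrightarrow> h' (x, 1) = k x"
    "\<And>x t. x \<in> A \<Longrightarrow> t \<in> {0..1} \<Longrightarrow> h' (x, t) \<in> D"
    using assms(2) by (rule pair_homotopicE) blast
  \<comment> \<open>Clamping the time parameter by \<open>min\<close> and \<open>max\<close> makes
    both halves continuous on the whole cylinder. At time 1/2 the clamped times are 1 and 0, where
    both homotopies equal \<open>g\<close>.\<close>
  have 1: "continuous_map (kprod X ?I) Z (\<lambda>p. h (fst p, min 1 (2 * snd p)))"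
    by (rule continuous_map_compose[OF continuous_map_kprod_interval h(1), unfolded comp_def])
      (auto intro!: continuous_intros)
  have 2: "continuous_map (kprod X ?I) Z (\<lambda>p. h' (fst p, max 0 (2 * snd p - 1)))"
    by (rule continuous_map_compose[OF continuous_map_kprod_interval h'(1), unfolded comp_def])
      (auto intro!: continuous_intros)
  have "continuous_map (kprod X ?I) euclideanreal snd"
    using continuous_map_kprod_snd continuous_map_in_subtopology by blast
  then have "continuous_map (kprod X ?I) Z (\<lambda>p. if snd p \<le> 1/2 then h (fst p, min 1 (2 * snd p))
      else h' (fst p, max 0 (2 * snd p - 1)))"
    by (rule continuous_map_cases_le) (use h h' 1 2 in \<open>auto intro: continuous_map_from_subtopology\<close>)
  then show ?thesis
    by (rule pair_homotopicI) (use h h' in auto)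
qed

lemma pair_homotopic_postcompose:
  assumes "pair_homotopic X A Z D f g" and p: "continuous_map Z W p" "p ` D \<subseteq> E"
  shows "pair_homotopic X A W E (\<lambda>x. p (f x)) (\<lambda>x. p (g x))"
proof -
  obtain h where h: "continuous_map (kprod X (top_of_set {0..1::real})) Z h"
    "\<And>x. x \<in> topspace X \<Longrightarrow> h (x, 0) = f x" "\<And>x. x \<in> topspace X \<Longrightarrow> h (x, 1) = g x"
    "\<And>x t. x \<in> A \<Longrightarrow> t \<in> {0..1} \<Longrightarrow> h (x, t) \<in> D"
    using assms(1) by (rule pair_homotopicE) blast
  from continuous_map_compose[OF h(1) p(1)] show ?thesis
    by (rule pair_homotopicI) (use h p(2) in auto)
qed

lemma pair_homotopic_precompose:
  assumes "pair_homotopic X A Z D f g" and a: "continuous_map X' X a" "a ` A' \<subseteq> A"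
  shows "pair_homotopic X' A' Z D (\<lambda>x. f (a x)) (\<lambda>x. g (a x))"
proof -
  obtain h where h: "continuous_map (kprod X (top_of_set {0..1::real})) Z h"
    "\<And>x. x \<in> topspace X \<Longrightarrow> h (x, 0) = f x" "\<And>x. x \<in> topspace X \<Longrightarrow> h (x, 1) = g x"
    "\<And>x t. x \<in> A \<Longrightarrow> t \<in> {0..1} \<Longrightarrow> h (x, t) \<in> D"
    using assms(1) by (rule pair_homotopicE) blast
  have "continuous_map (kprod X' (top_of_set {0..1})) (kprod X (top_of_set {0..1::real}))
      (\<lambda>p. (a (fst p), snd p))"
    by (rule continuous_map_kprod_interval[OF a(1)]) auto
  from continuous_map_compose[OF this h(1)] show ?thesis
    by (rule pair_homotopicI) (use h a in \<open>auto simp: continuous_map_def Pi_iff\<close>)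
qed

lemma pair_homotopic_pairing:
  assumes "pair_homotopic X A Z D f f'" "pair_homotopic X A W E g g'"
  shows "pair_homotopic X A (kprod Z W) (D \<times> E) (\<lambda>x. (f x, g x)) (\<lambda>x. (f' x, g' x))"
proof -
  obtain h where h: "continuous_map (kprod X (top_of_set {0..1::real})) Z h"
    "\<And>x. x \<in> topspace X \<Longrightarrow> h (x, 0) = f x" "\<And>x. x \<in> topspace X \<Longrightarrow> h (x, 1) = f' x"
    "\<And>x t. x \<in> A \<Longrightarrow> t \<in> {0..1} \<Longrightarrow> h (x, t) \<in> D"
    using assms(1) by (rule pair_homotopicE) blast
  obtain k where k: "continuous_map (kprod X (top_of_set {0..1::real})) W k"
    "\<And>x. x \<in> topspace X \<Longrightarrow> k (x, 0) = g x" "\<And>x. x \<in> topspace X \<Longrightarrow> k (x, 1) = g' x"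
    "\<And>x t. x \<in> A \<Longrightarrow> t \<in> {0..1} \<Longrightarrow> k (x, t) \<in> E"
    using assms(2) by (rule pair_homotopicE) blast
  from continuous_map_into_kprod[OF is_k_space_kprod h(1) k(1)] show ?thesis
    by (rule pair_homotopicI) (use h k in auto)
qed

text \<open>Needed because \<open>pointwise_add\<close> is \<open>undefined\<close> off the space
  while the homotopies of \<open>Z\<close> give plain function expressions.\<close>

lemma pair_homotopic_cong:
  assumes "pair_homotopic X A Z D f g"
    and "\<And>x. x \<in> topspace X \<Longrightarrow> f' x = f x" "\<And>x. x \<in> topspace X \<Longrightarrow> g' x = g x"
  shows "pair_homotopic X A Z D f' g'"
  using assms unfolding pair_homotopic_def khomotopic_with_def by auto

lemma equiv_pair_rel: "equiv (pair_maps X A Z D) (pair_rel X A Z D)"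
proof (rule equivI)
  show "refl_on (pair_maps X A Z D) (pair_rel X A Z D)"
    by (rule refl_onI) (auto simp: pair_rel_def pair_maps_def maps_def intro: pair_homotopic_refl)
  show "sym (pair_rel X A Z D)"
    by (rule symI) (auto simp: pair_rel_def intro: pair_homotopic_sym)
  show "trans (pair_rel X A Z D)"
    by (rule transI) (auto simp: pair_rel_def intro: pair_homotopic_trans)
qed (auto simp: pair_rel_def)

section \<open>Groups of equivalence classes\<close>

text \<open>The common shape of \<open>pair_class_group\<close> and
  \<open>section_class_group\<close>, so that quotients and their isomorphisms are treated once for
  both.\<close>

definition class_monoid :: "'a set \<Rightarrow> ('a \<times> 'a) set \<Rightarrow> ('a \<Rightarrow> 'a \<Rightarrow> 'a) \<Rightarrow> 'a \<Rightarrow> 'a set monoid" where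
  "class_monoid M R op e =
     \<lparr>carrier = M // R, mult = (\<lambda>c d. \<Union>f\<in>c. \<Union>g\<in>d. R `` {op f g}), one = R `` {e}\<rparr>"

text \<open>By congruence all the sets in the double union coincide, so any representatives may be
  used.\<close>

lemma mult_class_monoid:
  assumes "equiv M R"
    and "\<And>f f' g g'. (f, f') \<in> R \<Longrightarrow> (g, g') \<in> R \<Longrightarrow> (op f g, op f' g') \<in> R"
    and "f \<in> M" "g \<in> M"
  shows "R `` {f} \<otimes>\<^bsub>class_monoid M R op e\<^esub> R `` {g} = R `` {op f g}"
proof -
  have "congruent2 R R (\<lambda>f g. R `` {op f g})"
    by (rule congruent2I') (rule equiv_class_eq[OF assms(1,2)])
  then show ?thesis
    using UN_equiv_class2[OF assms(1,1)] assms by (simp add: class_monoid_def)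
qed

text \<open>Laws that hold only up to \<open>R\<close> become equations between classes. With
  commutativity, a left unit and left inverses suffice.\<close>

lemma comm_group_class_monoid:
  assumes R: "equiv M R"
    and cong: "\<And>f f' g g'. (f, f') \<in> R \<Longrightarrow> (g, g') \<in> R \<Longrightarrow> (op f g, op f' g') \<in> R"
    and e: "e \<in> M"
    and assoc: "\<And>f g h. f \<in> M \<Longrightarrow> g \<in> M \<Longrightarrow> h \<in> M \<Longrightarrow> (op (op f g) h, op f (op g h)) \<in> R"
    and comm: "\<And>f g. f \<in> M \<Longrightarrow> g \<in> M \<Longrightarrow> (op f g, op g f) \<in> R"
    and unit: "\<And>f. f \<in> M \<Longrightarrow> (op e f, f) \<in> R"
    and inv: "\<And>f. f \<in> M \<Longrightarrow> \<exists>g\<in>M. (op g f, e) \<in> R"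
  shows "comm_group (class_monoid M R op e)" (is "comm_group ?G")
proof -
  note mult = mult_class_monoid[OF R cong, where e = e]
  \<comment> \<open>Closure under \<open>op\<close> is read off from \<open>comm\<close>, since
    \<open>R\<close> relates only elements of \<open>M\<close>.\<close>
  have op: "op f g \<in> M" if "f \<in> M" "g \<in> M" for f g
    using comm[OF that] R unfolding equiv_def by blast
  have carrier: "carrier ?G = M // R" and one: "\<one>\<^bsub>?G\<^esub> = R `` {e}"
    by (auto simp: class_monoid_def)
  note eq = equiv_class_eq[OF R]
  show ?thesis
  proof (rule comm_groupI)
    show "\<one>\<^bsub>?G\<^esub> \<in> carrier ?G" using e by (simp add: carrier one quotientI)
    fix x assume "x \<in> carrier ?G"
    then obtain f where f: "f \<in> M" "x = R `` {f}" by (auto simp: carrier elim: quotientE)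
    show "\<one>\<^bsub>?G\<^esub> \<otimes>\<^bsub>?G\<^esub> x = x"
      using f e eq[OF unit] by (simp add: one mult)
    obtain g where g: "g \<in> M" "(op g f, e) \<in> R" using inv f by blast
    then show "\<exists>y\<in>carrier ?G. y \<otimes>\<^bsub>?G\<^esub> x = \<one>\<^bsub>?G\<^esub>"
      using f eq[OF g(2)] by (intro bexI[of _ "R `` {g}"]) (auto simp: one carrier mult quotientI)
    fix y assume "y \<in> carrier ?G"
    then obtain g where g: "g \<in> M" "y = R `` {g}" by (auto simp: carrier elim: quotientE)
    show "x \<otimes>\<^bsub>?G\<^esub> y \<in> carrier ?G"
      using f g by (simp add: carrier mult op quotientI)
    show "x \<otimes>\<^bsub>?G\<^esub> y = y \<otimes>\<^bsub>?G\<^esub> x"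
      using f g eq[OF comm] by (simp add: mult)
    fix z assume "z \<in> carrier ?G"
    then obtain h where h: "h \<in> M" "z = R `` {h}" by (auto simp: carrier elim: quotientE)
    show "x \<otimes>\<^bsub>?G\<^esub> y \<otimes>\<^bsub>?G\<^esub> z = x \<otimes>\<^bsub>?G\<^esub> (y \<otimes>\<^bsub>?G\<^esub> z)"
      using f g h eq[OF assoc] by (simp add: mult op)
  qed
qed

text \<open>Every member of the class of \<open>\<phi> f\<close> has a preimage in \<open>M\<close>,
  so the induced map on classes is simply the direct image.\<close>

lemma image_equiv_class:
  assumes R: "R \<subseteq> M \<times> M" and S: "S \<subseteq> N \<times> N" and \<phi>: "bij_betw \<phi> M N"
    and rel: "\<And>f g. f \<in> M \<Longrightarrow> g \<in> M \<Longrightarrow> (\<phi> f, \<phi> g) \<in> S \<longleftrightarrow> (f, g) \<in> R"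
    and f: "f \<in> M"
  shows "\<phi> ` (R `` {f}) = S `` {\<phi> f}"
proof
  show "\<phi> ` (R `` {f}) \<subseteq> S `` {\<phi> f}" using R rel by blast
  show "S `` {\<phi> f} \<subseteq> \<phi> ` (R `` {f})"
  proof
    fix t assume t: "t \<in> S `` {\<phi> f}"
    then obtain g where "g \<in> M" "t = \<phi> g" using S \<phi> by (auto simp: bij_betw_def)
    then show "t \<in> \<phi> ` (R `` {f})" using t rel f by blast
  qed
qed

text \<open>A bijection of representatives that matches relations and operations strictly carries
  the union defining one product termwise onto the union defining the other.\<close>

lemma image_class_monoid_iso:
  assumes R: "R \<subseteq> M \<times> M" and S: "S \<subseteq> N \<times> N" and \<phi>: "bij_betw \<phi> M N"
    and rel: "\<And>f g. f \<in> M \<Longrightarrow> g \<in> M \<Longrightarrow> (\<phi> f, \<phi> g) \<in> S \<longleftrightarrow> (f, g) \<in> R"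
    and op: "\<And>f g. f \<in> M \<Longrightarrow> g \<in> M \<Longrightarrow> op f g \<in> M"
    and op': "\<And>f g. f \<in> M \<Longrightarrow> g \<in> M \<Longrightarrow> op' (\<phi> f) (\<phi> g) = \<phi> (op f g)"
  shows "image \<phi> \<in> iso (class_monoid M R op e) (class_monoid N S op' e')"
proof -
  have inj: "inj_on \<phi> M" and N: "N = \<phi> ` M" using \<phi> by (auto simp: bij_betw_def)
  note cls = image_equiv_class[OF R S \<phi> rel]
  have sub: "c \<subseteq> M" if "c \<in> M // R" for c
    using that R by (auto elim!: quotientE)
  have "bij_betw (image \<phi>) (M // R) (N // S)"
    unfolding bij_betw_def
  proof
    \<comment> \<open>Classes are subsets of \<open>M\<close>, where \<phi> is injective, so they
      are determined by their images.\<close>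
    show "inj_on (image \<phi>) (M // R)"
      using inj sub by (auto simp: inj_on_def inj_on_image_eq_iff)
    have "image \<phi> ` (M // R) = (\<lambda>f. \<phi> ` (R `` {f})) ` M"
      by (auto simp: quotient_def)
    also have "\<dots> = N // S"
      by (auto simp: quotient_def cls N)
    finally show "image \<phi> ` (M // R) = N // S" .
  qed
  moreover have "\<phi> ` (\<Union>f\<in>c. \<Union>g\<in>d. R `` {op f g}) = (\<Union>s\<in>\<phi> ` c. \<Union>t\<in>\<phi> ` d. S `` {op' s t})"
    if "c \<in> M // R" "d \<in> M // R" for c d
  proof -
    have "\<phi> ` (R `` {op f g}) = S `` {op' (\<phi> f) (\<phi> g)}" if "f \<in> c" "g \<in> d" for f g
    proof -
      have "f \<in> M" "g \<in> M" using that sub \<open>c \<in> M // R\<close> \<open>d \<in> M // R\<close> by blast+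
      then show ?thesis using cls op op' by simp
    qed
    then show ?thesis by (simp add: image_UN)
  qed
  ultimately show "image \<phi> \<in> iso (class_monoid M R op e) (class_monoid N S op' e')"
    by (auto simp: iso_def hom_def class_monoid_def bij_betw_def)
qed

section \<open>Addition of homotopy classes\<close>

lemma pair_class_group_eq:
  "pair_class_group X A Z z0 m =
     class_monoid (pair_maps X A Z {z0}) (pair_rel X A Z {z0}) (pointwise_add X m) (\<lambda>x\<in>topspace X. z0)"
  by (simp add: pair_class_group_def class_monoid_def pair_class_def)

lemma section_class_group_eq:
  "section_class_group Y B q Z b0 z0 m =
     class_monoid (based_sections Y B q Z b0 z0) (section_rel Y B q Z b0 z0) (section_add Y B q m)
       (\<lambda>b\<in>topspace B. (b, \<lambda>y\<in>fibre Y q b. z0))"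
  by (simp add: section_class_group_def class_monoid_def section_class_def)

lemma pair_mapsD:
  assumes "f \<in> pair_maps X A Z D"
  shows "continuous_map X Z f" "f ` A \<subseteq> D" "f \<in> extensional (topspace X)"
  using assms by (auto simp: pair_maps_def maps_def)

lemma restrict_in_pair_maps:
  assumes "continuous_map X Z f" "A \<subseteq> topspace X" "f ` A \<subseteq> D"
  shows "restrict f (topspace X) \<in> pair_maps X A Z D"
  using assms by (auto simp: pair_maps_def maps_def intro: continuous_map_eq)

lemma continuous_map_H_mult:
  assumes "is_k_space X" "continuous_map (kprod Z Z) Z m" "continuous_map X Z f" "continuous_map X Z g"
  shows "continuous_map X Z (\<lambda>x. m (f x, g x))"
  using continuous_map_compose[OF continuous_map_into_kprod[OF assms(1,3,4)] assms(2)]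
  by (simp add: comp_def)

section \<open>Group laws for homotopy classes, inherited from the H-group\<close>

context
  fixes X :: "'a topology" and A :: "'a set" and Z :: "'z topology" and z0 :: 'z and m
  assumes X: "is_k_space X" and A: "A \<subseteq> topspace X" and Z: "H_group Z z0 m"
begin

lemma pointwise_add_in_pair_maps:
  assumes "f \<in> pair_maps X A Z {z0}" "g \<in> pair_maps X A Z {z0}"
  shows "pointwise_add X m f g \<in> pair_maps X A Z {z0}"
  unfolding pointwise_add_def
proof (rule restrict_in_pair_maps[OF continuous_map_H_mult[OF X] A])
  show "continuous_map (kprod Z Z) Z m" using Z by (simp add: H_group_def)
  show "(\<lambda>x. m (f x, g x)) ` A \<subseteq> {z0}"
    using Z pair_mapsD(2)[OF assms(1)] pair_mapsD(2)[OF assms(2)]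
    by (auto simp: H_group_def image_subset_iff)
qed (use assms pair_mapsD in auto)

lemma pair_rel_pointwise_add:
  assumes "(f, f') \<in> pair_rel X A Z {z0}" "(g, g') \<in> pair_rel X A Z {z0}"
  shows "(pointwise_add X m f g, pointwise_add X m f' g') \<in> pair_rel X A Z {z0}"
proof -
  have "pair_homotopic X A (kprod Z Z) ({z0} \<times> {z0}) (\<lambda>x. (f x, g x)) (\<lambda>x. (f' x, g' x))"
    using assms by (intro pair_homotopic_pairing) (auto simp: pair_rel_def)
  then have "pair_homotopic X A Z {z0} (\<lambda>x. m (f x, g x)) (\<lambda>x. m (f' x, g' x))"
    by (rule pair_homotopic_postcompose) (use Z in \<open>auto simp: H_group_def\<close>)
  then have "pair_homotopic X A Z {z0} (pointwise_add X m f g) (pointwise_add X m f' g')"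
    by (rule pair_homotopic_cong) (auto simp: pointwise_add_def)
  then show ?thesis
    using assms pointwise_add_in_pair_maps by (auto simp: pair_rel_def)
qed

text \<open>Substitution into a structure homotopy of \<open>Z\<close>: here \<open>W\<close> is
  \<open>Z\<close> or a product of copies of it, and \<open>a\<close> collects the maps to be added.
  As \<open>a\<close> sends \<open>A\<close> to the basepoint, a based homotopy turns into a
  homotopy of pairs.\<close>

lemma pair_rel_of_based_homotopic:
  assumes hom: "based_homotopic W w0 Z z0 u v" and a: "continuous_map X W a" "\<And>x. x \<in> A \<Longrightarrow> a x = w0"
    and f: "f \<in> pair_maps X A Z {z0}" "\<And>x. x \<in> topspace X \<Longrightarrow> f x = u (a x)"
    and g: "g \<in> pair_maps X A Z {z0}" "\<And>x. x \<in> topspace X \<Longrightarrow> g x = v (a x)"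
  shows "(f, g) \<in> pair_rel X A Z {z0}"
proof -
  have "pair_homotopic X A Z {z0} (\<lambda>x. u (a x)) (\<lambda>x. v (a x))"
    using hom a(1) by (rule pair_homotopic_precompose) (use a(2) in auto)
  then have "pair_homotopic X A Z {z0} f g"
    by (rule pair_homotopic_cong) (use f g in auto)
  then show ?thesis using f g by (simp add: pair_rel_def)
qed

lemma comm_group_pair_class_group:
  assumes comm: "homotopy_abelian_H_group Z z0 m"
  shows "comm_group (pair_class_group X A Z z0 m)"
  unfolding pair_class_group_eq
proof (rule comm_group_class_monoid[OF equiv_pair_rel pair_rel_pointwise_add])
  let ?M = "pair_maps X A Z {z0}" and ?e = "\<lambda>x\<in>topspace X. z0"
  show e: "?e \<in> ?M"
    by (rule restrict_in_pair_maps) (use A Z in \<open>auto simp: H_group_def\<close>)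
  have val: "f x = z0" if "f \<in> ?M" "x \<in> A" for f x
    using pair_mapsD(2)[OF that(1)] that(2) by auto
  note add = pointwise_add_in_pair_maps
  note cont = pair_mapsD(1)
  have addval: "pointwise_add X m f g x = m (f x, g x)" if "x \<in> topspace X" for f g x
    using that by (simp add: pointwise_add_def)
  fix f assume f: "f \<in> ?M"
  have unit: "based_homotopic Z z0 Z z0 (\<lambda>z. m (z0, z)) (\<lambda>z. z)"
    using Z by (simp add: H_group_def)
  show "(pointwise_add X m ?e f, f) \<in> pair_rel X A Z {z0}"
    by (rule pair_rel_of_based_homotopic[OF unit cont[OF f] val[OF f] add[OF e f] _ f])
      (simp_all add: addval)
  obtain j where j: "continuous_map Z Z j" "j z0 = z0"
    "based_homotopic Z z0 Z z0 (\<lambda>z. m (j z, z)) (\<lambda>_. z0)"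
    using Z unfolding H_group_def by blast
  let ?g = "\<lambda>x\<in>topspace X. j (f x)"
  have g: "?g \<in> ?M"
    using continuous_map_compose[OF cont[OF f] j(1)] A j(2) val[OF f]
    by (intro restrict_in_pair_maps) (auto simp: comp_def)
  have "(pointwise_add X m ?g f, ?e) \<in> pair_rel X A Z {z0}"
    by (rule pair_rel_of_based_homotopic[OF j(3) cont[OF f] val[OF f] add[OF g f] _ e])
      (simp_all add: addval)
  with g show "\<exists>g\<in>?M. (pointwise_add X m g f, ?e) \<in> pair_rel X A Z {z0}" by blast
  fix g assume g: "g \<in> ?M"
  have fg: "continuous_map X (kprod Z Z) (\<lambda>x. (f x, g x))"
    using X cont[OF f] cont[OF g] by (rule continuous_map_into_kprod)
  have comm': "based_homotopic (kprod Z Z) (z0, z0) Z z0 (\<lambda>(x, y). m (y, x)) m"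
    using comm by (simp add: homotopy_abelian_H_group_def)
  show "(pointwise_add X m f g, pointwise_add X m g f) \<in> pair_rel X A Z {z0}"
    \<comment> \<open>The assumed homotopy starts at the swapped multiplication, so it is reversed
      to start at \<open>m\<close>.\<close>
    by (rule pair_rel_of_based_homotopic[OF pair_homotopic_sym[OF comm'] fg _ add[OF f g] _ add[OF g f]])
      (simp_all add: addval val[OF f] val[OF g])
  fix h assume h: "h \<in> ?M"
  have assoc: "based_homotopic (kprod (kprod Z Z) Z) ((z0, z0), z0) Z z0
       (\<lambda>((x, y), z). m (m (x, y), z)) (\<lambda>((x, y), z). m (x, m (y, z)))"
    using Z by (simp add: H_group_def)
  show "(pointwise_add X m (pointwise_add X m f g) h, pointwise_add X m f (pointwise_add X m g h))
      \<in> pair_rel X A Z {z0}"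
    by (rule pair_rel_of_based_homotopic[OF assoc continuous_map_into_kprod[OF X fg cont[OF h]] _
          add[OF add[OF f g] h] _ add[OF f add[OF g h]]])
      (simp_all add: addval val[OF f] val[OF g] val[OF h])
qed

end

section \<open>Maps of pairs and based sections\<close>

context
  fixes Y :: "'y topology" and Z :: "'z topology" and B :: "'b topology"
    and q :: "'y \<Rightarrow> 'b" and b0 :: 'b and z0 :: 'z
  assumes Y: "is_k_space Y" and B: "is_k_space B" "weak_Hausdorff B" and b0: "b0 \<in> topspace B"
    and q: "continuous_map Y B q"
begin

text \<open>The exponential law with parameter space \<open>B\<close>, base map the identity, and
  \<open>h (b, y) = l y\<close>. The basepoint condition holds because \<open>l\<close> is constant
  on the fibre over \<open>b0\<close>.\<close>

lemma bullet_in_based_sections: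
  assumes l: "l \<in> pair_maps Y (fibre Y q b0) Z {z0}"
  shows "bullet Y B q l \<in> based_sections Y B q Z b0 z0"
proof -
  have "continuous_map (kprod B Y) Z (\<lambda>p. l (snd p))"
    using continuous_map_compose[OF continuous_map_kprod_snd pair_mapsD(1)[OF l]]
    by (simp add: comp_def)
  from continuous_map_into_free_range_space[OF B(1) Y B(2) q continuous_map_id this]
  have "continuous_map B (free_range_space Y B q Z) (\<lambda>b. (b, restrict l (fibre Y q b)))"
    by simp
  then have "continuous_map B (free_range_space Y B q Z) (bullet Y B q l)"
    by (rule continuous_map_eq) (simp add: bullet_def)
  moreover have "restrict l (fibre Y q b0) = (\<lambda>y\<in>fibre Y q b0. z0)"
    using pair_mapsD(2)[OF l] by (intro restrict_ext) blast
  ultimately show ?thesis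
    using b0 by (auto simp: based_sections_def is_based_section_def bullet_def
        free_range_proj_def free_range_base_def)
qed

text \<open>Each \<open>y\<close> lies in the fibre over \<open>q y\<close>, so the restrictions to
  fibres determine the map.\<close>

lemma bullet_inj_on: "inj_on (bullet Y B q) (pair_maps Y (fibre Y q b0) Z {z0})"
proof (rule inj_onI)
  fix l l' assume l: "l \<in> pair_maps Y (fibre Y q b0) Z {z0}" and l': "l' \<in> pair_maps Y (fibre Y q b0) Z {z0}"
    and eq: "bullet Y B q l = bullet Y B q l'"
  show "l = l'"
  proof (rule extensionalityI[OF pair_mapsD(3)[OF l] pair_mapsD(3)[OF l']])
    fix y assume y: "y \<in> topspace Y"
    then have "q y \<in> topspace B" using q by (auto simp: continuous_map_def)
    then have "restrict l (fibre Y q (q y)) = restrict l' (fibre Y q (q y))"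
      using fun_cong[OF eq, of "q y"] by (simp add: bullet_def)
    then show "l y = l' y"
      using y by (metis (mono_tags, lifting) fibre_def mem_Collect_eq restrict_apply')
  qed
qed

lemma based_section_eval:
  assumes "is_based_section Y B q Z b0 z0 s"
  shows "\<And>b. b \<in> topspace B \<Longrightarrow> fst (s b) = b \<and> snd (s b) \<in> extensional (fibre Y q b)"
    and "\<And>y. y \<in> fibre Y q b0 \<Longrightarrow> snd (s (q y)) y = z0"
proof -
  fix b assume b: "b \<in> topspace B"
  have "s b \<in> free_range_maps Y B q Z"
    using assms b by (auto simp: is_based_section_def continuous_map_def)
  moreover have "fst (s b) = b"
    using assms b by (auto simp: is_based_section_def free_range_proj_def)
  ultimately show "fst (s b) = b \<and> snd (s b) \<in> extensional (fibre Y q b)"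
    by (auto simp: free_range_maps_def maps_def)
next
  show "snd (s (q y)) y = z0" if "y \<in> fibre Y q b0" for y
    using assms that by (auto simp: is_based_section_def free_range_base_def fibre_def)
qed

text \<open>A section \<open>s\<close> is glued to the map
  \<open>y \<mapsto> snd (s (q y)) y\<close>, which is continuous by evaluating
  \<open>s \<circ> q\<close> along the identity of \<open>Y\<close>.\<close>

lemma bullet_surj:
  assumes s: "s \<in> based_sections Y B q Z b0 z0"
  shows "s \<in> bullet Y B q ` pair_maps Y (fibre Y q b0) Z {z0}"
proof
  have s': "is_based_section Y B q Z b0 z0 s" and ext: "s \<in> extensional (topspace B)"
    using s by (auto simp: based_sections_def)
  let ?l = "\<lambda>y\<in>topspace Y. snd (s (q y)) y"
  have qB: "q y \<in> topspace B" if "y \<in> topspace Y" for y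
    using q that by (auto simp: continuous_map_def)
  have "continuous_map Y (free_range_space Y B q Z) (s \<circ> q)"
    using q s' unfolding is_based_section_def by (blast intro: continuous_map_compose)
  from continuous_map_free_range_eval[OF Y Y B(2) q continuous_map_id this]
  have "continuous_map Y Z (\<lambda>y. snd (s (q y)) y)"
    using based_section_eval(1)[OF s'] qB by simp
  then show "?l \<in> pair_maps Y (fibre Y q b0) Z {z0}"
    using based_section_eval(2)[OF s'] by (intro restrict_in_pair_maps) (auto simp: fibre_def)
  show "s = bullet Y B q ?l"
  proof (rule extensionalityI[OF ext])
    show "bullet Y B q ?l \<in> extensional (topspace B)" by (simp add: bullet_def)
    fix b assume b: "b \<in> topspace B"
    have "snd (s b) = restrict ?l (fibre Y q b)"
      by (rule extensionalityI[of _ "fibre Y q b"])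
        (use based_section_eval(1)[OF s' b] in \<open>auto simp: fibre_def\<close>)
    then show "s b = bullet Y B q ?l b"
      using based_section_eval(1)[OF s' b] b by (simp add: bullet_def prod_eq_iff)
  qed
qed

text \<open>The correspondence between maps and sections repeated with a time parameter: evaluation
  turns vertical homotopies into homotopies of pairs, and the adjoint construction goes
  back.\<close>

lemma section_rel_bullet_iff:
  assumes l: "l \<in> pair_maps Y (fibre Y q b0) Z {z0}" and l': "l' \<in> pair_maps Y (fibre Y q b0) Z {z0}"
  shows "(bullet Y B q l, bullet Y B q l') \<in> section_rel Y B q Z b0 z0 \<longleftrightarrow>
    (l, l') \<in> pair_rel Y (fibre Y q b0) Z {z0}"
proof
  let ?I = "top_of_set {0..1::real}" and ?F = "free_range_space Y B q Z"
  have qB: "q y \<in> topspace B" if "y \<in> topspace Y" for y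
    using q that by (auto simp: continuous_map_def)
  assume "(bullet Y B q l, bullet Y B q l') \<in> section_rel Y B q Z b0 z0"
  then obtain h where h: "continuous_map (kprod B ?I) ?F h"
    "\<forall>b\<in>topspace B. h (b, 0) = bullet Y B q l b" "\<forall>b\<in>topspace B. h (b, 1) = bullet Y B q l' b"
    and sec: "\<And>t. t \<in> {0..1} \<Longrightarrow> is_based_section Y B q Z b0 z0 (\<lambda>b. h (b, t))"
    unfolding section_rel_def khomotopic_with_def by blast
  have "pair_homotopic Y (fibre Y q b0) Z {z0} l l'"
  proof (rule pair_homotopicI)
    have qI: "continuous_map (kprod Y ?I) (kprod B ?I) (\<lambda>p. (q (fst p), snd p))"
      by (rule continuous_map_kprod_interval[OF q]) auto
    show "continuous_map (kprod Y ?I) Z (\<lambda>p. snd ((h \<circ> (\<lambda>p. (q (fst p), snd p))) p) (fst p))"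
    \<comment> \<open>Evaluation over the cylinder of \<open>Y\<close>, along its projection to
      \<open>Y\<close>. The required compatibility holds because each stage of \<open>h\<close> is a
      section.\<close>
    proof (rule continuous_map_free_range_eval[OF is_k_space_kprod Y B(2) q continuous_map_kprod_fst
          continuous_map_compose[OF qI h(1)]])
      fix p assume "p \<in> topspace (kprod Y ?I)"
      then show "fst ((h \<circ> (\<lambda>p. (q (fst p), snd p))) p) = q (fst p)"
        using based_section_eval(1)[OF sec[of "snd p"]] qB by auto
    qed
  qed (use h(2,3) qB based_section_eval(2)[OF sec] in \<open>auto simp: bullet_def fibre_def\<close>)
  then show "(l, l') \<in> pair_rel Y (fibre Y q b0) Z {z0}"
    using l l' by (simp add: pair_rel_def)
next
  let ?I = "top_of_set {0..1::real}" and ?F = "free_range_space Y B q Z"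
  assume "(l, l') \<in> pair_rel Y (fibre Y q b0) Z {z0}"
  then have "pair_homotopic Y (fibre Y q b0) Z {z0} l l'" by (simp add: pair_rel_def)
  then obtain h where h: "continuous_map (kprod Y ?I) Z h"
    "\<And>x. x \<in> topspace Y \<Longrightarrow> h (x, 0) = l x" "\<And>x. x \<in> topspace Y \<Longrightarrow> h (x, 1) = l' x"
    "\<And>x t. x \<in> fibre Y q b0 \<Longrightarrow> t \<in> {0..1} \<Longrightarrow> h (x, t) \<in> {z0}"
    by (rule pair_homotopicE) blast
  \<comment> \<open>The adjoint of \<open>h\<close> with the cylinder of \<open>B\<close> as
    parameter space; only the first coordinate of \<open>p\<close> selects the fibre, which makes
    the homotopy vertical.\<close>
  let ?k = "\<lambda>p. (fst p, \<lambda>y\<in>fibre Y q (fst p). h (y, snd p))"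
  have "continuous_map (kprod (kprod B ?I) Y) (kprod Y ?I) (\<lambda>p. (snd p, snd (fst p)))"
    using continuous_map_compose[OF continuous_map_kprod_fst continuous_map_kprod_snd]
    by (intro continuous_map_into_kprod continuous_map_kprod_snd) (simp_all add: comp_def)
  from continuous_map_into_free_range_space[OF is_k_space_kprod Y B(2) q continuous_map_kprod_fst
      continuous_map_compose[OF this h(1)]]
  have k: "continuous_map (kprod B ?I) ?F ?k" by simp
  have "is_based_section Y B q Z b0 z0 (\<lambda>b. ?k (b, t))" if t: "t \<in> {0..1}" for t
    unfolding is_based_section_def
  proof (intro conjI ballI)
    show "continuous_map B ?F (\<lambda>b. ?k (b, t))"
      using t by (intro continuous_map_kprod_slice[OF B(1) k]) simp
    have "(\<lambda>y\<in>fibre Y q b0. h (y, t)) = (\<lambda>y\<in>fibre Y q b0. z0)"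
      using h(4)[OF _ t] by (intro restrict_ext) blast
    then show "?k (b0, t) = free_range_base Y q b0 z0" by (simp add: free_range_base_def)
  qed (simp add: free_range_proj_def)
  moreover have "?k (b, 0) = bullet Y B q l b" "?k (b, 1) = bullet Y B q l' b" if "b \<in> topspace B" for b
    using that h(2,3) by (auto simp: bullet_def fibre_def intro!: restrict_ext)
  ultimately have "khomotopic_with (is_based_section Y B q Z b0 z0) B ?F (bullet Y B q l) (bullet Y B q l')"
    unfolding khomotopic_with_def using k by blast
  then show "(bullet Y B q l, bullet Y B q l') \<in> section_rel Y B q Z b0 z0"
    using bullet_in_based_sections l l' by (simp add: section_rel_def)
qed

end

text \<open>Over each \<open>b\<close>, both sides are the restriction of
  \<open>y \<mapsto> m (l y, l' y)\<close> to the fibre, so the additions agree before passing to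
  classes.\<close>

lemma bullet_pointwise_add:
  "section_add Y B q m (bullet Y B q l) (bullet Y B q l') = bullet Y B q (pointwise_add Y m l l')"
  unfolding section_add_def bullet_def fibrewise_mult_def pointwise_add_def
  by (rule restrict_ext) (auto simp: fibre_def intro!: restrict_ext)

theorem theorem7:
  fixes Y :: "'y topology" and Z :: "'z topology" and B :: "'b topology"
    and q :: "'y \<Rightarrow> 'b" and m :: "'z \<times> 'z \<Rightarrow> 'z" and z0 :: 'z and b0 :: 'b
  assumes "is_k_space Y" and "is_k_space Z" and "is_k_space B"
    and "homotopy_abelian_H_group Z z0 m"
    and "weak_Hausdorff B" and "b0 \<in> topspace B"
    and "continuous_map Y B q"
  shows
    "(comm_group (pair_class_group Y (fibre Y q b0) Z z0 m) \<and>
      (\<forall>l1 \<in> pair_maps Y (fibre Y q b0) Z {z0}. \<forall>l2 \<in> pair_maps Y (fibre Y q b0) Z {z0}.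
         pair_class Y (fibre Y q b0) Z {z0} l1
           \<otimes>\<^bsub>pair_class_group Y (fibre Y q b0) Z z0 m\<^esub> pair_class Y (fibre Y q b0) Z {z0} l2
         = pair_class Y (fibre Y q b0) Z {z0} (pointwise_add Y m l1 l2))) \<and>
     (group (section_class_group Y B q Z b0 z0 m) \<and>
      (\<forall>t1 \<in> based_sections Y B q Z b0 z0. \<forall>t2 \<in> based_sections Y B q Z b0 z0.
         section_class Y B q Z b0 z0 t1
           \<otimes>\<^bsub>section_class_group Y B q Z b0 z0 m\<^esub> section_class Y B q Z b0 z0 t2
         = section_class Y B q Z b0 z0 (section_add Y B q m t1 t2)) \<and>
      (\<exists>\<Lambda> \<in> iso (pair_class_group Y (fibre Y q b0) Z z0 m) (section_class_group Y B q Z b0 z0 m).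
         \<forall>l \<in> pair_maps Y (fibre Y q b0) Z {z0}.
           \<Lambda> (pair_class Y (fibre Y q b0) Z {z0} l) = section_class Y B q Z b0 z0 (bullet Y B q l)))"
proof -
  let ?A = "fibre Y q b0"
  let ?M = "pair_maps Y ?A Z {z0}" and ?N = "based_sections Y B q Z b0 z0"
  let ?R = "pair_rel Y ?A Z {z0}" and ?S = "section_rel Y B q Z b0 z0"
  let ?G = "pair_class_group Y ?A Z z0 m" and ?H = "section_class_group Y B q Z b0 z0 m"
  let ?e = "\<lambda>y\<in>topspace Y. z0"
  have A: "?A \<subseteq> topspace Y" by (auto simp: fibre_def)
  have Z: "H_group Z z0 m" using assms(4) by (simp add: homotopy_abelian_H_group_def)
  note add = pointwise_add_in_pair_maps[OF assms(1) A Z]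
  have G: "comm_group ?G"
    using assms(1) A Z assms(4) by (rule comm_group_pair_class_group)
  then interpret G: comm_group ?G .
  have mult: "pair_class Y ?A Z {z0} l \<otimes>\<^bsub>?G\<^esub> pair_class Y ?A Z {z0} l' =
      pair_class Y ?A Z {z0} (pointwise_add Y m l l')" if "l \<in> ?M" "l' \<in> ?M" for l l'
    unfolding pair_class_group_eq pair_class_def
    using mult_class_monoid[OF equiv_pair_rel pair_rel_pointwise_add[OF assms(1) A Z] that] .
  note ctx = assms(1,3,5,6,7)
  have bij: "bij_betw (bullet Y B q) ?M ?N"
    using bullet_inj_on[OF ctx] bullet_surj[OF ctx] bullet_in_based_sections[OF ctx]
    by (auto simp: bij_betw_def)
  have R: "?R \<subseteq> ?M \<times> ?M" and S: "?S \<subseteq> ?N \<times> ?N"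
    by (auto simp: pair_rel_def section_rel_def)
  have iso: "image (bullet Y B q) \<in> iso ?G ?H"
    unfolding pair_class_group_eq section_class_group_eq
  proof (rule image_class_monoid_iso[OF R S bij])
    fix l l' assume l: "l \<in> ?M" "l' \<in> ?M"
    then show "(bullet Y B q l, bullet Y B q l') \<in> ?S \<longleftrightarrow> (l, l') \<in> ?R"
      by (rule section_rel_bullet_iff[OF ctx])
    show "pointwise_add Y m l l' \<in> ?M" using l by (rule add)
  qed (rule bullet_pointwise_add)
  have cls: "bullet Y B q ` pair_class Y ?A Z {z0} l = section_class Y B q Z b0 z0 (bullet Y B q l)"
    if "l \<in> ?M" for l
    unfolding pair_class_def section_class_def
    by (rule image_equiv_class[OF R S bij section_rel_bullet_iff[OF ctx] that])
  have "?e \<in> ?M"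
    by (rule restrict_in_pair_maps) (use A Z in \<open>auto simp: H_group_def\<close>)
  moreover have "bullet Y B q ?e = (\<lambda>b\<in>topspace B. (b, \<lambda>y\<in>fibre Y q b. z0))"
    by (auto simp: bullet_def fibre_def fun_eq_iff)
  \<comment> \<open>An isomorphism makes its target a group once the unit there is replaced by the
    image of the unit. This equation shows that the replacement leaves \<open>?H\<close>
    unchanged.\<close>
  ultimately have "bullet Y B q ` \<one>\<^bsub>?G\<^esub> = \<one>\<^bsub>?H\<^esub>"
    using cls by (simp add: pair_class_group_def section_class_group_def)
  then have H: "group ?H"
    using G.iso_imp_img_group[OF iso] by simp
  have mult': "section_class Y B q Z b0 z0 t1 \<otimes>\<^bsub>?H\<^esub> section_class Y B q Z b0 z0 t2
      = section_class Y B q Z b0 z0 (section_add Y B q m t1 t2)" if t: "t1 \<in> ?N" "t2 \<in> ?N" for t1 t2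
  proof -
    \<comment> \<open>Sections are written as images of maps of pairs, so that independence of
      representatives carries over from \<open>?G\<close>.\<close>
    obtain l1 l2 where l: "l1 \<in> ?M" "l2 \<in> ?M" "t1 = bullet Y B q l1" "t2 = bullet Y B q l2"
      using bullet_surj[OF ctx t(1)] bullet_surj[OF ctx t(2)] by blast
    have "pair_class Y ?A Z {z0} l \<in> carrier ?G" if "l \<in> ?M" for l
      using that by (simp add: pair_class_group_def pair_class_def quotientI)
    then have "section_class Y B q Z b0 z0 t1 \<otimes>\<^bsub>?H\<^esub> section_class Y B q Z b0 z0 t2
        = bullet Y B q ` (pair_class Y ?A Z {z0} l1 \<otimes>\<^bsub>?G\<^esub> pair_class Y ?A Z {z0} l2)"
      using l(1,2) hom_mult[of "image (bullet Y B q)" ?G ?H] iso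
      by (simp add: l(3,4) cls[symmetric] iso_def)
    then show ?thesis
      using l by (simp add: mult cls add bullet_pointwise_add)
  qed
  show ?thesis
    by (intro conjI ballI bexI[of _ "image (bullet Y B q)"] G mult H mult' iso cls)
qed

end
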